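(* Let $\boldsymbol f$ be a global (defined for all $t\ge0$) solution of the flow $$\partial_t\boldsymbol f=\boldsymbol\kappa-\frac{L}{2A}\boldsymbol\nu$$ of closed plane curves, such that the initial rotation number is $1$ and the initial signed area is positive. Then the curve converges to a circle exponentially as $t\to\infty$ in the following sense. There exist $C>0$ and $\lambda>0$ independent of $t$ such that $$0\le I_{-1}(t)\le Ce^{-\lambda t}\qquad(t\ge0).$$ Furthermore, $A(t)$ and $L(t)$ converge as $t\to\infty$ to positive constants $A_\infty$ and $L_\infty$ respectively. They satisfy $4\pi A_\infty=L_\infty^2$, and (for suitable constants $C,\lambda>0$ independent of $t$) $$0\le A_\infty-A(t)\le Ce^{-\lambda t},\qquad |L(t)-L_\infty|\le Ce^{-\lambda t}\qquad(t\ge0).$$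
   Context: For a closed plane curve of length $L$ with arc-length parametrization $\boldsymbol f=(f_1,f_2):\mathbb R/L\mathbb Z\to\mathbb R^2$, let $\boldsymbol\nu=(-\partial_sf_2,\partial_sf_1)$ be the unit normal, $\boldsymbol\kappa=\partial_s^2\boldsymbol f$ the curvature vector, $\kappa=\boldsymbol\kappa\cdot\boldsymbol\nu$ the curvature, and $A=-\frac12\int_0^L\boldsymbol f\cdot\boldsymbol\nu\,ds$ the signed area. Rotation number $1$ means $\int_0^L\kappa\,ds=2\pi$. Curves need not be simple or convex. Set $I_{-1}=1-\frac{4\pi A}{L^2}$. A global solution of the flow is a smooth family of immersed closed curves $F:\mathbb R/\mathbb Z\times[0,\infty)\to\mathbb R^2$ such that, at each fixed parameter $p\in\mathbb R/\mathbb Z$, $\partial_tF(p,t)=\boldsymbol\kappa-\frac{L(t)}{2A(t)}\boldsymbol\nu$ evaluated at the point $F(p,t)$ of the curve $F(\cdot,t)$; $\boldsymbol f(\cdot,t):\mathbb R/L(t)\mathbb Z\to\mathbb R^2$ is the arc-length parametrization of $F(\cdot,t)$, and $L(t),A(t),I_{-1}(t)$ are the quantities of the curve at time $t$. *)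

theory Defs
  imports "HOL-Analysis.Analysis"
begin

text \<open>
  A closed plane curve, defined on the reals modulo 1, is a function on the real line of period 1.
\<close>

definition closed_immersed_curve :: "(real \<Rightarrow> real ^ 2) \<Rightarrow> bool" where
  "closed_immersed_curve c \<longleftrightarrow>
     (\<forall>p. c (p + 1) = c p) \<and>
     (\<forall>p. c differentiable (at p)) \<and>
     (\<forall>p. vector_derivative c (at p) \<noteq> 0)"

definition curve_length :: "(real \<Rightarrow> real ^ 2) \<Rightarrow> real" where
  "curve_length c = integral {0..1} (\<lambda>p. norm (vector_derivative c (at p)))"

text \<open>
  The interval integral is oriented, so \<open>arclength c p\<close> is negative for negative \<open>p\<close>. For an
  immersed closed curve (with continuous derivative) it is an increasing bijection of the real line,
  and \<open>arclength_param c\<close> is the arc-length parametrization with base point \<open>c 0\<close>, periodic with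
  period \<open>curve_length c\<close>.
\<close>

definition arclength :: "(real \<Rightarrow> real ^ 2) \<Rightarrow> real \<Rightarrow> real" where
  "arclength c p = (LBINT q=0..p. norm (vector_derivative c (at q)))"

definition arclength_param :: "(real \<Rightarrow> real ^ 2) \<Rightarrow> real \<Rightarrow> real ^ 2" where
  "arclength_param c = c \<circ> inv (arclength c)"

definition tangent :: "(real \<Rightarrow> real ^ 2) \<Rightarrow> real \<Rightarrow> real ^ 2" where
  "tangent c s = vector_derivative (arclength_param c) (at s)"

definition unit_normal :: "(real \<Rightarrow> real ^ 2) \<Rightarrow> real \<Rightarrow> real ^ 2" where
  "unit_normal c s = vector [- (tangent c s $ 2), tangent c s $ 1]"

definition curvature_vector :: "(real \<Rightarrow> real ^ 2) \<Rightarrow> real \<Rightarrow> real ^ 2" where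
  "curvature_vector c s = vector_derivative (tangent c) (at s)"

definition curvature :: "(real \<Rightarrow> real ^ 2) \<Rightarrow> real \<Rightarrow> real" where
  "curvature c s = curvature_vector c s \<bullet> unit_normal c s"

definition signed_area :: "(real \<Rightarrow> real ^ 2) \<Rightarrow> real" where
  "signed_area c =
     - (1 / 2) * integral {0..curve_length c} (\<lambda>s. arclength_param c s \<bullet> unit_normal c s)"

definition rotation_number :: "(real \<Rightarrow> real ^ 2) \<Rightarrow> real" where
  "rotation_number c = integral {0..curve_length c} (curvature c) / (2 * pi)"

definition isoperimetric_deficit :: "(real \<Rightarrow> real ^ 2) \<Rightarrow> real" where
  "isoperimetric_deficit c = 1 - 4 * pi * signed_area c / (curve_length c)\<^sup>2"

text \<open>
  \<open>F\<close> is of class \<open>C\<^sup>\<infinity>\<close> on the closed half plane \<open>t \<ge> 0\<close>: all mixed partial derivatives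
  \<open>D i j\<close> (\<open>i\<close> times in \<open>p\<close>, \<open>j\<close> times in \<open>t\<close>, one-sided at \<open>t = 0\<close>) exist and are jointly
  continuous up to the boundary.
\<close>

definition smooth_family :: "(real \<Rightarrow> real \<Rightarrow> real ^ 2) \<Rightarrow> bool" where
  "smooth_family F \<longleftrightarrow>
     (\<exists>D :: nat \<Rightarrow> nat \<Rightarrow> real \<Rightarrow> real \<Rightarrow> real ^ 2.
        (\<forall>p. \<forall>t\<ge>0. D 0 0 p t = F p t) \<and>
        (\<forall>i j. continuous_on (UNIV \<times> {0..}) (\<lambda>(p, t). D i j p t)) \<and>
        (\<forall>i j p. \<forall>t\<ge>0. ((\<lambda>q. D i j q t) has_vector_derivative D (Suc i) j p t) (at p)) \<and>
        (\<forall>i j p. \<forall>t\<ge>0.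
           ((\<lambda>\<tau>. D i j p \<tau>) has_vector_derivative D i (Suc j) p t) (at t within {0..})))"

text \<open>
  The requirement that the area does not vanish is implicit in the flow equation, which divides
  by it. Values of \<open>F\<close> at negative times play no role.
\<close>

definition global_solution :: "(real \<Rightarrow> real \<Rightarrow> real ^ 2) \<Rightarrow> bool" where
  "global_solution F \<longleftrightarrow>
     smooth_family F \<and>
     (\<forall>t\<ge>0. closed_immersed_curve (\<lambda>p. F p t)) \<and>
     (\<forall>t\<ge>0. signed_area (\<lambda>p. F p t) \<noteq> 0) \<and>
     (\<forall>t\<ge>0. \<forall>p.
        let c = (\<lambda>q. F q t); s = arclength c p in
        ((\<lambda>\<tau>. F p \<tau>) has_vector_derivative
           curvature_vector c s
             - (curve_length c / (2 * signed_area c)) *\<^sub>R unit_normal c s)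
          (at t within {0..}))"

end

theory Submission
  imports Defs
begin

text \<open>
  Write \<open>I\<close> for the isoperimetric deficit \<open>1 - 4 * pi * A / L\<^sup>2\<close> and \<open>K\<close> for the integral of the squared
  curvature with respect to arc length. A motion with normal velocity \<open>V\<close> changes length at the rate
  \<open>- \<integral> V \<kappa>\<close> and area at the rate \<open>- \<integral> V\<close>, and it preserves the total curvature \<open>2 * pi\<close>. With
  \<open>V = \<kappa> - L / (2 * A)\<close> this gives \<open>L' = pi * L / A - K\<close> and \<open>A' = L\<^sup>2 / (2 * A) - 2 * pi\<close>, and therefore
    \<open>I' = - (2 * pi / A) * I\<^sup>2 - (8 * pi * A / L^4) * (L * K - 4 * pi\<^sup>2)\<close>.

  The first term alone would only yield algebraic decay. Exponential decay comes from a reverse estimate: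
  for every closed curve of rotation number one, simple or not,
    \<open>0 \<le> 2 * pi\<^sup>2 * I \<le> L * K - 4 * pi\<^sup>2\<close>
  (\<open>isoperimetric_deficit_nonneg\<close> and \<open>isoperimetric_deficit_le_curvature_energy\<close>). In Fourier terms,
  with \<open>L = 2 * pi\<close> and \<open>f = \<Sum> a\<^sub>n exp (i n s)\<close>, the deficit is \<open>\<Sum> n (n - 1) \<bar>a\<^sub>n\<bar>\<^sup>2\<close>, while the curvature energy
  in the upper bound is a multiple of \<open>\<Sum> n\<^sup>2 (n - 1)\<^sup>2 \<bar>a\<^sub>n\<bar>\<^sup>2\<close>: it is the Dirichlet energy of the tangent,
  seen in a frame that rotates once along the curve. The proof replaces Fourier series by Wirtinger's
  inequality, applied to the curve for the lower bound, and for the upper bound first to the rotated tangent and then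
  to the curve without its first mode.

  The reverse estimate gives \<open>I' \<le> - (a / A) * I\<close> with a constant \<open>a > 0\<close>, whereas \<open>A' \<le> b * I\<close>. Hence
  \<open>I + (a / b) * ln A\<close> does not increase, which bounds the nondecreasing function \<open>A\<close>; then \<open>I\<close> decays
  exponentially, \<open>A\<close> converges at the rate of \<open>I\<close>, and so does \<open>L\<close> because \<open>L\<^sup>2 * (1 - I) = 4 * pi * A\<close>
  (\<open>deficit_ode_convergence\<close>).
\<close>

section \<open>Wirtinger's inequality for periodic functions\<close>

text \<open>
  The function \<open>\<phi> s = - l * tan (l * (s - m))\<close> solves the Riccati equation \<open>\<phi>' + \<phi>\<^sup>2 = - l\<^sup>2\<close>, so that
  \<open>(u' - \<phi> * u)\<^sup>2 = u'\<^sup>2 - l\<^sup>2 * u\<^sup>2 - (\<phi> * u\<^sup>2)'\<close>. Integrating this square gives the bound. The smallness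
  conditions keep the interval away from the poles of the tangent, so no limit at an endpoint is needed.
\<close>

lemma tan_energy_bound:
  fixes u u' :: "real \<Rightarrow> real"
  assumes "a \<le> b" and "l > 0"
    and u: "\<And>s. s \<in> {a..b} \<Longrightarrow> (u has_real_derivative u' s) (at s within {a..b})"
    and cont: "continuous_on {a..b} u'"
    and small: "l * (m - a) < pi / 2" "l * (b - m) < pi / 2"
  shows "l\<^sup>2 * integral {a..b} (\<lambda>s. (u s)\<^sup>2)
           - ((u b)\<^sup>2 * (l * tan (l * (b - m))) - (u a)\<^sup>2 * (l * tan (l * (a - m))))
         \<le> integral {a..b} (\<lambda>s. (u' s)\<^sup>2)"
proof -
  define \<tau> where "\<tau> s = tan (l * (s - m))" for s
  have cos_nz: "cos (l * (s - m)) \<noteq> 0" if "s \<in> {a..b}" for s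
  proof -
    have "l * (a - m) \<le> l * (s - m)" "l * (s - m) \<le> l * (b - m)"
      using that \<open>l > 0\<close> by (auto intro!: mult_left_mono)
    moreover have "l * (m - a) = - (l * (a - m))" by (simp add: algebra_simps)
    ultimately have "cos (l * (s - m)) > 0"
      using small by (intro cos_gt_zero_pi) linarith+
    then show ?thesis by simp
  qed
  have cu: "continuous_on {a..b} u"
    using u by (meson DERIV_continuous_on)
  have deriv: "((\<lambda>s. (u s)\<^sup>2 * (l * \<tau> s)) has_vector_derivative
      (2 * u s * u' s * (l * \<tau> s) + (u s)\<^sup>2 * (l\<^sup>2 * (1 + (\<tau> s)\<^sup>2)))) (at s within {a..b})"
    if s: "s \<in> {a..b}" for s
  proof -
    have "((\<lambda>s. tan (l * (s - m))) has_real_derivative inverse ((cos (l * (s - m)))\<^sup>2) * l)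
            (at s within {a..b})"
      using cos_nz[OF s] by (auto intro!: derivative_eq_intros)
    moreover have "inverse ((cos (l * (s - m)))\<^sup>2) = 1 + (\<tau> s)\<^sup>2"
      using tan_sec[OF cos_nz[OF s]] by (simp add: \<tau>_def power_inverse)
    ultimately have "(\<tau> has_real_derivative (1 + (\<tau> s)\<^sup>2) * l) (at s within {a..b})"
      by (simp add: \<tau>_def[abs_def])
    then show ?thesis
      unfolding has_real_derivative_iff_has_vector_derivative[symmetric]
      using u[OF s] by (auto intro!: derivative_eq_intros simp: power2_eq_square algebra_simps)
  qed
  have "((\<lambda>s. 2 * u s * u' s * (l * \<tau> s) + (u s)\<^sup>2 * (l\<^sup>2 * (1 + (\<tau> s)\<^sup>2)))
          has_integral ((u b)\<^sup>2 * (l * \<tau> b) - (u a)\<^sup>2 * (l * \<tau> a))) {a..b}"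
    using fundamental_theorem_of_calculus[OF \<open>a \<le> b\<close> deriv] by simp
  then have lhs: "((\<lambda>s. l\<^sup>2 * (u s)\<^sup>2
        - (2 * u s * u' s * (l * \<tau> s) + (u s)\<^sup>2 * (l\<^sup>2 * (1 + (\<tau> s)\<^sup>2))))
      has_integral (l\<^sup>2 * integral {a..b} (\<lambda>s. (u s)\<^sup>2)
        - ((u b)\<^sup>2 * (l * \<tau> b) - (u a)\<^sup>2 * (l * \<tau> a)))) {a..b}"
    by (intro has_integral_diff has_integral_mult_right integrable_integral
        integrable_continuous_interval continuous_intros cu)
  have rhs: "((\<lambda>s. (u' s)\<^sup>2) has_integral integral {a..b} (\<lambda>s. (u' s)\<^sup>2)) {a..b}"
    by (intro integrable_integral integrable_continuous_interval continuous_intros cont)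
  have "l\<^sup>2 * integral {a..b} (\<lambda>s. (u s)\<^sup>2)
        - ((u b)\<^sup>2 * (l * \<tau> b) - (u a)\<^sup>2 * (l * \<tau> a)) \<le> integral {a..b} (\<lambda>s. (u' s)\<^sup>2)"
  proof (rule has_integral_le[OF lhs rhs])
    fix s
    have "0 \<le> (u' s + u s * (l * \<tau> s))\<^sup>2" by simp
    then show "l\<^sup>2 * (u s)\<^sup>2
        - (2 * u s * u' s * (l * \<tau> s) + (u s)\<^sup>2 * (l\<^sup>2 * (1 + (\<tau> s)\<^sup>2))) \<le> (u' s)\<^sup>2"
      by (simp add: power2_eq_square algebra_simps)
  qed
  then show ?thesis by (simp add: \<tau>_def)
qed

text \<open>
  By the intermediate value theorem some value \<open>c\<close> is taken at two points half a period apart. They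
  split the period into two arcs of length \<open>P / 2\<close> with \<open>u - c\<close> vanishing at the ends, and on such an
  arc \<open>tan_energy_bound\<close> applies with every \<open>l\<close> below \<open>2 * pi / P\<close>.
\<close>

lemma wirtinger_shifted:
  fixes u u' :: "real \<Rightarrow> real"
  assumes "P > 0"
    and u: "\<And>s. s \<in> {0..P} \<Longrightarrow> (u has_real_derivative u' s) (at s within {0..P})"
    and cont: "continuous_on {0..P} u'"
    and periodic: "u P = u 0"
  obtains c where
    "(2 * pi / P)\<^sup>2 * integral {0..P} (\<lambda>s. (u s - c)\<^sup>2) \<le> integral {0..P} (\<lambda>s. (u' s)\<^sup>2)"
proof -
  have cu: "continuous_on {0..P} u"
    using u by (meson DERIV_continuous_on)
  have "\<exists>p\<in>{0..P/2}. u (p + P/2) - u p = 0"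
  proof -
    have c: "continuous_on {0..P/2} (\<lambda>p. u (p + P/2) - u p)"
      using \<open>P > 0\<close> by (intro continuous_intros continuous_on_compose2[OF cu]) auto
    show ?thesis
    proof (cases "u (P/2) - u 0 \<le> 0")
      case True
      then show ?thesis
        using IVT'[of "\<lambda>p. u (p + P/2) - u p" 0 0 "P/2"] c periodic \<open>P > 0\<close> by auto
    next
      case False
      then show ?thesis
        using IVT2'[of "\<lambda>p. u (p + P/2) - u p" "P/2" 0 0] c periodic \<open>P > 0\<close> by auto
    qed
  qed
  then obtain p where p: "0 \<le> p" "p \<le> P/2" "u (p + P/2) = u p" by auto
  define w where "w s = u s - u p" for s
  have w: "(w has_real_derivative u' s) (at s within S)" if "s \<in> {0..P}" "S \<subseteq> {0..P}" for s S
    unfolding w_def using DERIV_subset[OF u] that by (auto intro!: derivative_eq_intros)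
  have cw: "continuous_on {0..P} w" unfolding w_def by (intro continuous_intros cu)
  have zero: "w p = 0" "w (p + P/2) = 0" "w P = w 0" using p periodic by (auto simp: w_def)
  define W where "W = integral {0..P} (\<lambda>s. (w s)\<^sup>2)"
  define E where "E = integral {0..P} (\<lambda>s. (u' s)\<^sup>2)"
  have split: "integral {0..P} f
      = integral {0..p} f + integral {p..p + P/2} f + integral {p + P/2..P} f"
    if "continuous_on {0..P} f" for f :: "real \<Rightarrow> real"
  proof -
    have int: "f integrable_on {0..P}" using that by (rule integrable_continuous_interval)
    then have "f integrable_on {0..p + P/2}"
      by (rule integrable_subinterval_real) (use p in auto)
    with int p show ?thesis
      using Henstock_Kurzweil_Integration.integral_combine[of 0 "p + P/2" P f]
        Henstock_Kurzweil_Integration.integral_combine[of 0 p "p + P/2" f] by auto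
  qed
  have sub: "l\<^sup>2 * W \<le> E" if l: "0 < l" "l < 2 * pi / P" for l
  proof -
    have lP: "l * (P / 4) < pi / 2" using l \<open>P > 0\<close> by (simp add: field_simps)
    have lp: "l * (P / 4 - p) \<le> l * (P / 4)" "l * (p - P / 4) \<le> l * (P / 4)"
      using l p by auto
    note lP' = lP le_less_trans[OF lp(1) lP] le_less_trans[OF lp(2) lP]
    \<comment> \<open>Each interval uses a tangent function centred at the midpoint of its arc. One arc crosses the end of
      the period and appears as two intervals; the boundary terms at \<open>0\<close> and \<open>P\<close> cancel because the
      two centres differ by \<open>P\<close>.\<close>
    have piece: "l\<^sup>2 * integral {a..b} (\<lambda>s. (w s)\<^sup>2)
          - ((w b)\<^sup>2 * (l * tan (l * (b - m))) - (w a)\<^sup>2 * (l * tan (l * (a - m))))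
        \<le> integral {a..b} (\<lambda>s. (u' s)\<^sup>2)"
      if "0 \<le> a" "a \<le> b" "b \<le> P" "l * (m - a) < pi / 2" "l * (b - m) < pi / 2" for a b m
      by (intro tan_energy_bound)
        (use that l in \<open>auto intro!: w continuous_on_subset[OF cont]\<close>)
    have 1: "l\<^sup>2 * integral {p..p + P/2} (\<lambda>s. (w s)\<^sup>2) \<le> integral {p..p + P/2} (\<lambda>s. (u' s)\<^sup>2)"
      using piece[of p "p + P/2" "p + P/4"] p lP zero \<open>P > 0\<close> by auto
    have 2: "l\<^sup>2 * integral {0..p} (\<lambda>s. (w s)\<^sup>2) + (w 0)\<^sup>2 * (l * tan (l * (P/4 - p)))
        \<le> integral {0..p} (\<lambda>s. (u' s)\<^sup>2)"
      using piece[of 0 p "p - P/4"] p lP' zero \<open>P > 0\<close> by auto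
    have 3: "l\<^sup>2 * integral {p + P/2..P} (\<lambda>s. (w s)\<^sup>2) - (w 0)\<^sup>2 * (l * tan (l * (P/4 - p)))
        \<le> integral {p + P/2..P} (\<lambda>s. (u' s)\<^sup>2)"
    proof -
      have "p + P/2 - (p + 3 * P/4) = - (P/4)" "P - (p + 3 * P/4) = P/4 - p"
        "p + 3 * P/4 - (p + P/2) = P/4" by auto
      then show ?thesis
        using piece[of "p + P/2" P "p + 3 * P/4"] p lP' zero \<open>P > 0\<close> by auto
    qed
    show ?thesis
      unfolding W_def E_def using 1 2 3
      by (subst (1 2) split) (auto intro!: continuous_intros cw cont simp: algebra_simps)
  qed
  have "(2 * pi / P)\<^sup>2 * W \<le> E"
  proof (rule field_le_mult_one_interval)
    \<comment> \<open>The factor \<open>z\<close> amounts to the admissible choice \<open>l = sqrt z * (2 * pi / P)\<close>.\<close>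
    fix z :: real assume z: "0 < z" "z < 1"
    have "z * (2 * pi / P)\<^sup>2 = (sqrt z * (2 * pi / P))\<^sup>2"
      using z by (subst power_mult_distrib) simp
    moreover have "sqrt z * (2 * pi / P) < 2 * pi / P" "0 < sqrt z * (2 * pi / P)"
      using z \<open>P > 0\<close> by (auto simp: field_simps)
    ultimately show "z * ((2 * pi / P)\<^sup>2 * W) \<le> E"
      using sub by (metis mult.assoc)
  qed
  then show thesis using that unfolding W_def E_def w_def by blast
qed

text \<open>
  Among all constants, the mean is the closest to \<open>u\<close> in the quadratic mean.
\<close>

lemma wirtinger_mean_zero:
  fixes u u' :: "real \<Rightarrow> real"
  assumes "P > 0"
    and u: "\<And>s. s \<in> {0..P} \<Longrightarrow> (u has_real_derivative u' s) (at s within {0..P})"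
    and cont: "continuous_on {0..P} u'"
    and periodic: "u P = u 0"
    and mean: "integral {0..P} u = 0"
  shows "(2 * pi / P)\<^sup>2 * integral {0..P} (\<lambda>s. (u s)\<^sup>2) \<le> integral {0..P} (\<lambda>s. (u' s)\<^sup>2)"
proof -
  obtain c where c:
    "(2 * pi / P)\<^sup>2 * integral {0..P} (\<lambda>s. (u s - c)\<^sup>2) \<le> integral {0..P} (\<lambda>s. (u' s)\<^sup>2)"
    using wirtinger_shifted[OF assms(1-4)] by blast
  have cu: "continuous_on {0..P} u" using u by (meson DERIV_continuous_on)
  have "((\<lambda>s. (u s)\<^sup>2 - 2 * c * u s + c\<^sup>2) has_integral
      (integral {0..P} (\<lambda>s. (u s)\<^sup>2) - 2 * c * integral {0..P} u + (P - 0) * c\<^sup>2)) {0..P}"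
    using \<open>P > 0\<close> has_integral_const_real[of "c\<^sup>2" 0 P]
    by (intro has_integral_add has_integral_diff has_integral_mult_right integrable_integral
        integrable_continuous_interval continuous_intros cu) auto
  then have "integral {0..P} (\<lambda>s. (u s - c)\<^sup>2) = integral {0..P} (\<lambda>s. (u s)\<^sup>2) + P * c\<^sup>2"
    using mean by (simp add: integral_unique power2_diff algebra_simps)
  then have "integral {0..P} (\<lambda>s. (u s)\<^sup>2) \<le> integral {0..P} (\<lambda>s. (u s - c)\<^sup>2)"
    using \<open>P > 0\<close> by simp
  with c show ?thesis
    by (smt (verit) mult_left_mono zero_le_power2)
qed

section \<open>Unit-speed closed plane curves\<close>

lemma rotated_distance:
  fixes x y a b c s :: real
  assumes "c\<^sup>2 + s\<^sup>2 = 1"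
  shows "(x * c + y * s - a)\<^sup>2 + (y * c - x * s - b)\<^sup>2
       = (x - (a * c - b * s))\<^sup>2 + (y - (a * s + b * c))\<^sup>2"
proof -
  have "(x * c + y * s - a)\<^sup>2 + (y * c - x * s - b)\<^sup>2
      - ((x - (a * c - b * s))\<^sup>2 + (y - (a * s + b * c))\<^sup>2)
      = (x\<^sup>2 + y\<^sup>2 - a\<^sup>2 - b\<^sup>2) * (c\<^sup>2 + s\<^sup>2 - 1)"
    by (simp add: power2_eq_square algebra_simps)
  then show ?thesis using assms by simp
qed

text \<open>
  The isoperimetric inequality in Hurwitz's form, for either orientation. The area integral does not see
  translations, so both coordinates may be given mean zero; then Young's inequality bounds the area
  integral by the energy and the squared coordinates, and Wirtinger's inequality absorbs the latter into
  the energy.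
\<close>

lemma area_form_le_energy:
  fixes X Y X' Y' :: "real \<Rightarrow> real"
  assumes "P > 0"
    and X: "\<And>s. s \<in> {0..P} \<Longrightarrow> (X has_real_derivative X' s) (at s within {0..P})"
    and Y: "\<And>s. s \<in> {0..P} \<Longrightarrow> (Y has_real_derivative Y' s) (at s within {0..P})"
    and cX: "continuous_on {0..P} X'" and cY: "continuous_on {0..P} Y'"
    and closed: "X P = X 0" "Y P = Y 0"
  shows "\<bar>(2 * pi / P) * integral {0..P} (\<lambda>s. X s * Y' s - Y s * X' s)\<bar>
         \<le> integral {0..P} (\<lambda>s. (X' s)\<^sup>2 + (Y' s)\<^sup>2)"
proof -
  define w where "w = 2 * pi / P"
  define U where "U s = X s - integral {0..P} X / P" for s
  define V where "V s = Y s - integral {0..P} Y / P" for s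
  have c: "continuous_on {0..P} X" "continuous_on {0..P} Y"
    by (rule DERIV_continuous_on, erule X Y)+
  have cUV: "continuous_on {0..P} U" "continuous_on {0..P} V"
    unfolding U_def V_def by (intro continuous_intros c)+
  note int = integrable_integral[OF integrable_continuous_interval]
  have const: "((\<lambda>s. k) has_integral P * k) {0..P}" for k
    using has_integral_const_real[of k 0 P] \<open>P > 0\<close> by simp
  have U: "(U has_real_derivative X' s) (at s within {0..P})" if "s \<in> {0..P}" for s
    unfolding U_def using X[OF that] by (auto intro!: derivative_eq_intros)
  have V: "(V has_real_derivative Y' s) (at s within {0..P})" if "s \<in> {0..P}" for s
    unfolding V_def using Y[OF that] by (auto intro!: derivative_eq_intros)
  have "integral {0..P} U = 0"
    unfolding U_def
    using integral_unique[OF has_integral_diff[OF int[OF c(1)] const]] \<open>P > 0\<close> by simp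
  then have WU: "w\<^sup>2 * integral {0..P} (\<lambda>s. (U s)\<^sup>2) \<le> integral {0..P} (\<lambda>s. (X' s)\<^sup>2)"
    unfolding w_def using closed
    by (intro wirtinger_mean_zero[OF \<open>P > 0\<close> U cX]) (auto simp: U_def)
  have "integral {0..P} V = 0"
    unfolding V_def
    using integral_unique[OF has_integral_diff[OF int[OF c(2)] const]] \<open>P > 0\<close> by simp
  then have WV: "w\<^sup>2 * integral {0..P} (\<lambda>s. (V s)\<^sup>2) \<le> integral {0..P} (\<lambda>s. (Y' s)\<^sup>2)"
    unfolding w_def using closed
    by (intro wirtinger_mean_zero[OF \<open>P > 0\<close> V cY]) (auto simp: V_def)
  define S where "S = integral {0..P} (\<lambda>s. X s * Y' s - Y s * X' s)"
  define E where "E = integral {0..P} (\<lambda>s. (X' s)\<^sup>2 + (Y' s)\<^sup>2)"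
  have X0: "(X' has_integral 0) {0..P}"
    using fundamental_theorem_of_calculus[of 0 P X X'] X closed \<open>P > 0\<close>
    by (simp add: has_real_derivative_iff_has_vector_derivative)
  have Y0: "(Y' has_integral 0) {0..P}"
    using fundamental_theorem_of_calculus[of 0 P Y Y'] Y closed \<open>P > 0\<close>
    by (simp add: has_real_derivative_iff_has_vector_derivative)
  have "((\<lambda>s. X s * Y' s - Y s * X' s) has_integral S) {0..P}"
    unfolding S_def by (intro int continuous_intros c cX cY)
  from has_integral_add[OF has_integral_diff[OF this has_integral_mult_right[OF Y0,
        of "integral {0..P} X / P"]] has_integral_mult_right[OF X0, of "integral {0..P} Y / P"]]
  have S: "((\<lambda>s. U s * Y' s - V s * X' s) has_integral S) {0..P}"
    by (simp add: U_def V_def algebra_simps)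
  have E: "E = integral {0..P} (\<lambda>s. (X' s)\<^sup>2) + integral {0..P} (\<lambda>s. (Y' s)\<^sup>2)"
    unfolding E_def
    by (intro integral_unique has_integral_add int continuous_intros cX cY)
  have rhs: "((\<lambda>s. w\<^sup>2 * (U s)\<^sup>2 + w\<^sup>2 * (V s)\<^sup>2 + ((X' s)\<^sup>2 + (Y' s)\<^sup>2)) has_integral
      (w\<^sup>2 * integral {0..P} (\<lambda>s. (U s)\<^sup>2) + w\<^sup>2 * integral {0..P} (\<lambda>s. (V s)\<^sup>2) + E)) {0..P}"
    unfolding E_def
    by (intro has_integral_add has_integral_mult_right int continuous_intros cUV cX cY)
  have half: "(2 * (e * w)) * S \<le> 2 * E" if "e = 1 \<or> e = -1" for e
  proof -
    have "(2 * (e * w)) * S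
        \<le> w\<^sup>2 * integral {0..P} (\<lambda>s. (U s)\<^sup>2) + w\<^sup>2 * integral {0..P} (\<lambda>s. (V s)\<^sup>2) + E"
    proof (rule has_integral_le[OF has_integral_mult_right[OF S] rhs])
      fix s
      have "0 \<le> (w * U s - e * Y' s)\<^sup>2 + (w * V s + e * X' s)\<^sup>2" by simp
      then show "2 * (e * w) * (U s * Y' s - V s * X' s)
          \<le> w\<^sup>2 * (U s)\<^sup>2 + w\<^sup>2 * (V s)\<^sup>2 + ((X' s)\<^sup>2 + (Y' s)\<^sup>2)"
        using that by (auto simp: power2_eq_square algebra_simps)
    qed
    also have "\<dots> \<le> 2 * E" using WU WV E by simp
    finally show ?thesis .
  qed
  show ?thesis
    using half[of 1] half[of "-1"] unfolding S_def[symmetric] E_def[symmetric] w_def[symmetric]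
    by (simp add: abs_le_iff mult.commute)
qed

text \<open>
  The quadratic form \<open>\<integral> (X'\<^sup>2 + Y'\<^sup>2) - w \<integral> (X Y' - Y X')\<close> with \<open>w = 2 * pi / L\<close> equals \<open>L\<close> times the
  deficit on a unit-speed curve, and by \<open>area_form_le_energy\<close> it is at most twice the energy of any closed curve.
  It vanishes on circles run through once counterclockwise, and it is unchanged when such a circle is
  subtracted from the curve. It therefore suffices to find a circle that is close to the curve in energy.
  The tangent in the rotating frame, \<open>(G, H)\<close>, has derivative of length \<open>\<bar>k - w\<bar>\<close>, and
  Wirtinger's inequality provides a constant \<open>(a, b)\<close> near it; undoing the rotation and integrating
  gives the circle \<open>(m, n)\<close>.
\<close>

lemma deficit_le_curvature_energy:
  fixes X Y X' Y' k :: "real \<Rightarrow> real"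
  assumes "L > 0"
    and X: "\<And>s. s \<in> {0..L} \<Longrightarrow> (X has_real_derivative X' s) (at s within {0..L})"
    and Y: "\<And>s. s \<in> {0..L} \<Longrightarrow> (Y has_real_derivative Y' s) (at s within {0..L})"
    and X': "\<And>s. s \<in> {0..L} \<Longrightarrow> (X' has_real_derivative - k s * Y' s) (at s within {0..L})"
    and Y': "\<And>s. s \<in> {0..L} \<Longrightarrow> (Y' has_real_derivative k s * X' s) (at s within {0..L})"
    and k: "continuous_on {0..L} k"
    and unit: "\<And>s. (X' s)\<^sup>2 + (Y' s)\<^sup>2 = 1"
    and closed: "X L = X 0" "Y L = Y 0" "X' L = X' 0" "Y' L = Y' 0"
    and turning: "integral {0..L} k = 2 * pi"
  shows "2 * pi\<^sup>2 * (1 - 2 * pi * integral {0..L} (\<lambda>s. X s * Y' s - Y s * X' s) / L\<^sup>2)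
         \<le> L * integral {0..L} (\<lambda>s. (k s)\<^sup>2) - 4 * pi\<^sup>2"
proof -
  define w where "w = 2 * pi / L"
  have w: "w > 0" "w * L = 2 * pi" using \<open>L > 0\<close> by (auto simp: w_def)
  note int = integrable_integral[OF integrable_continuous_interval]
  have const: "((\<lambda>s. k) has_integral L * k) {0..L}" for k :: real
    using has_integral_const_real[of k 0 L] \<open>L > 0\<close> by simp
  have c: "continuous_on {0..L} X" "continuous_on {0..L} Y"
      "continuous_on {0..L} X'" "continuous_on {0..L} Y'"
    by (rule DERIV_continuous_on, erule X Y X' Y')+
  define G where "G s = X' s * cos (w * s) + Y' s * sin (w * s)" for s
  define H where "H s = Y' s * cos (w * s) - X' s * sin (w * s)" for s
  have G: "(G has_real_derivative (w - k s) * H s) (at s within {0..L})" if "s \<in> {0..L}" for s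
    unfolding G_def H_def
    by (auto intro!: derivative_eq_intros X' Y' that simp: algebra_simps)
  have H: "(H has_real_derivative (k s - w) * G s) (at s within {0..L})" if "s \<in> {0..L}" for s
    unfolding G_def H_def
    by (auto intro!: derivative_eq_intros X' Y' that simp: algebra_simps)
  have cGH: "continuous_on {0..L} G" "continuous_on {0..L} H"
    by (rule DERIV_continuous_on, erule G H)+
  have GH: "(G s)\<^sup>2 + (H s)\<^sup>2 = 1" for s
    using rotated_distance[of "cos (w * s)" "sin (w * s)" "X' s" "Y' s" 0 0] unit[of s]
    by (simp add: G_def H_def)
  have per: "G L = G 0" "H L = H 0"
    using closed w by (simp_all add: G_def H_def)
  have cGH': "continuous_on {0..L} (\<lambda>s. (w - k s) * H s)" "continuous_on {0..L} (\<lambda>s. (k s - w) * G s)"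
    by (intro continuous_intros k cGH)+
  obtain a where a: "w\<^sup>2 * integral {0..L} (\<lambda>s. (G s - a)\<^sup>2)
      \<le> integral {0..L} (\<lambda>s. ((w - k s) * H s)\<^sup>2)"
    using wirtinger_shifted[OF \<open>L > 0\<close> G cGH'(1) per(1)] unfolding w_def by blast
  obtain b where b: "w\<^sup>2 * integral {0..L} (\<lambda>s. (H s - b)\<^sup>2)
      \<le> integral {0..L} (\<lambda>s. ((k s - w) * G s)\<^sup>2)"
    using wirtinger_shifted[OF \<open>L > 0\<close> H cGH'(2) per(2)] unfolding w_def by blast
  define K where "K = integral {0..L} (\<lambda>s. (k s)\<^sup>2)"
  have energy: "w\<^sup>2 * integral {0..L} (\<lambda>s. (G s - a)\<^sup>2 + (H s - b)\<^sup>2) \<le> K - 4 * pi\<^sup>2 / L"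
  proof -
    have split: "integral {0..L} (\<lambda>s. (G s - a)\<^sup>2 + (H s - b)\<^sup>2)
        = integral {0..L} (\<lambda>s. (G s - a)\<^sup>2) + integral {0..L} (\<lambda>s. (H s - b)\<^sup>2)"
      by (intro integral_unique has_integral_add int continuous_intros cGH)
    have 1: "((\<lambda>s. ((w - k s) * H s)\<^sup>2 + ((k s - w) * G s)\<^sup>2) has_integral
        (integral {0..L} (\<lambda>s. ((w - k s) * H s)\<^sup>2) + integral {0..L} (\<lambda>s. ((k s - w) * G s)\<^sup>2)))
        {0..L}"
      by (intro has_integral_add int continuous_intros k cGH)
    have 2: "((w - k s) * H s)\<^sup>2 + ((k s - w) * G s)\<^sup>2 = (k s)\<^sup>2 - 2 * w * k s + w\<^sup>2" for s
    proof -
      have "((w - k s) * H s)\<^sup>2 + ((k s - w) * G s)\<^sup>2 = (k s - w)\<^sup>2 * ((G s)\<^sup>2 + (H s)\<^sup>2)"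
        by (simp add: power2_eq_square algebra_simps)
      then show ?thesis by (simp add: GH power2_diff)
    qed
    have 3: "((\<lambda>s. (k s)\<^sup>2 - 2 * w * k s + w\<^sup>2) has_integral
        (K - 2 * w * integral {0..L} k + L * w\<^sup>2)) {0..L}"
      unfolding K_def
      by (intro has_integral_add has_integral_diff has_integral_mult_right int const
          continuous_intros k)
    have "w\<^sup>2 * integral {0..L} (\<lambda>s. (G s - a)\<^sup>2 + (H s - b)\<^sup>2)
        \<le> integral {0..L} (\<lambda>s. ((w - k s) * H s)\<^sup>2) + integral {0..L} (\<lambda>s. ((k s - w) * G s)\<^sup>2)"
      unfolding split distrib_left by (rule add_mono[OF a b])
    also have "\<dots> = K - 2 * w * integral {0..L} k + L * w\<^sup>2"
      using has_integral_unique[OF 1[unfolded 2] 3] .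
    also have "\<dots> = K - 2 * w * (2 * pi) + L * w\<^sup>2" by (simp add: turning)
    also have "\<dots> = K - 4 * pi\<^sup>2 / L"
      using \<open>L > 0\<close> by (simp add: w_def field_simps power2_eq_square)
    finally show ?thesis .
  qed
  \<comment> \<open>The circle whose velocity is \<open>(a, b)\<close> turned by the angle \<open>w * s\<close>.\<close>
  define m where "m s = (a * sin (w * s) + b * cos (w * s)) / w" for s
  define n where "n s = (b * sin (w * s) - a * cos (w * s)) / w" for s
  have m: "(m has_real_derivative - w * n s) (at s within S)" for s S
    unfolding m_def n_def using w by (auto intro!: derivative_eq_intros simp: field_simps)
  have n: "(n has_real_derivative w * m s) (at s within S)" for s S
    unfolding m_def n_def using w by (auto intro!: derivative_eq_intros simp: field_simps)
  have cmn: "continuous_on {0..L} m" "continuous_on {0..L} n"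
    by (rule DERIV_continuous_on, rule m n)+
  have permn: "m L = m 0" "n L = n 0" using w by (simp_all add: m_def n_def)
  define S where "S = integral {0..L} (\<lambda>s. X s * Y' s - Y s * X' s)"
  define T where "T = integral {0..L}
    (\<lambda>s. (X s - m s) * (Y' s - w * m s) - (Y s - n s) * (X' s - - w * n s))"
  define E where "E = integral {0..L} (\<lambda>s. (X' s - - w * n s)\<^sup>2 + (Y' s - w * m s)\<^sup>2)"
  have E: "E = integral {0..L} (\<lambda>s. (G s - a)\<^sup>2 + (H s - b)\<^sup>2)"
  proof -
    have "(X' s - - w * n s)\<^sup>2 + (Y' s - w * m s)\<^sup>2 = (G s - a)\<^sup>2 + (H s - b)\<^sup>2" for s
    proof -
      have "- w * n s = a * cos (w * s) - b * sin (w * s)"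
        "w * m s = a * sin (w * s) + b * cos (w * s)"
        using w by (simp_all add: m_def n_def)
      then show ?thesis
        using rotated_distance[of "cos (w * s)" "sin (w * s)" "X' s" "Y' s" a b]
        by (simp only: G_def H_def) simp
    qed
    then show ?thesis by (simp add: E_def)
  qed
  have "\<bar>w * T\<bar> \<le> E"
    unfolding w_def T_def E_def
    by (intro area_form_le_energy \<open>L > 0\<close> DERIV_diff X Y m[unfolded w_def] n[unfolded w_def]
        continuous_intros c cmn) (auto simp: closed permn)
  moreover have "E - w * T = L - w * S"
  proof -
    \<comment> \<open>Subtracting the circle changes the integrand of the quadratic form by a total derivative.\<close>
    have "((\<lambda>s. w * (Y s * m s - X s * n s)) has_vector_derivative
        (w * (Y' s * m s - w * Y s * n s - X' s * n s - w * X s * m s))) (at s within {0..L})"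
      if "s \<in> {0..L}" for s
      unfolding has_real_derivative_iff_has_vector_derivative[symmetric]
      by (auto intro!: derivative_eq_intros X Y m n that simp: algebra_simps)
    from fundamental_theorem_of_calculus[OF _ this] \<open>L > 0\<close>
    have 0: "((\<lambda>s. w * (Y' s * m s - w * Y s * n s - X' s * n s - w * X s * m s))
        has_integral 0) {0..L}"
      by (simp add: closed permn)
    have new: "((\<lambda>s. 1 - w * (X s * Y' s - Y s * X' s)
          - w * (Y' s * m s - w * Y s * n s - X' s * n s - w * X s * m s))
        has_integral (L * 1 - w * S - 0)) {0..L}"
      unfolding S_def
      by (intro has_integral_diff has_integral_mult_right int const 0 continuous_intros c)
    have old: "((\<lambda>s. (X' s - - w * n s)\<^sup>2 + (Y' s - w * m s)\<^sup>2
          - w * ((X s - m s) * (Y' s - w * m s) - (Y s - n s) * (X' s - - w * n s)))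
        has_integral (E - w * T)) {0..L}"
      unfolding E_def T_def
      by (intro has_integral_diff has_integral_mult_right int continuous_intros c cmn)
    have eq: "(X' s - - w * n s)\<^sup>2 + (Y' s - w * m s)\<^sup>2
          - w * ((X s - m s) * (Y' s - w * m s) - (Y s - n s) * (X' s - - w * n s))
        = 1 - w * (X s * Y' s - Y s * X' s)
          - w * (Y' s * m s - w * Y s * n s - X' s * n s - w * X s * m s)" for s
    proof -
      have "(X' s - - w * n s)\<^sup>2 + (Y' s - w * m s)\<^sup>2
          - w * ((X s - m s) * (Y' s - w * m s) - (Y s - n s) * (X' s - - w * n s))
        = ((X' s)\<^sup>2 + (Y' s)\<^sup>2) - w * (X s * Y' s - Y s * X' s)
          - w * (Y' s * m s - w * Y s * n s - X' s * n s - w * X s * m s)"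
        by (simp add: power2_eq_square algebra_simps)
      then show ?thesis unfolding unit .
    qed
    show ?thesis using has_integral_unique[OF old[unfolded eq] new] by simp
  qed
  ultimately have "L - w * S \<le> 2 * E" by linarith
  then have "w\<^sup>2 * (L - w * S) \<le> 2 * (w\<^sup>2 * E)"
    using w by (simp add: mult.left_commute)
  also have "\<dots> \<le> 2 * (K - 4 * pi\<^sup>2 / L)" using energy E by simp
  finally have "L * (w\<^sup>2 * (L - w * S)) \<le> L * (2 * (K - 4 * pi\<^sup>2 / L))"
    using \<open>L > 0\<close> by (intro mult_left_mono) auto
  moreover have "L * (w\<^sup>2 * (L - w * S)) = 4 * pi\<^sup>2 * (1 - 2 * pi * S / L\<^sup>2)"
    using \<open>L > 0\<close> by (simp add: w_def field_simps power2_eq_square)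
  moreover have "L * (2 * (K - 4 * pi\<^sup>2 / L)) = 2 * (L * K - 4 * pi\<^sup>2)"
    using \<open>L > 0\<close> by (simp add: field_simps)
  ultimately show ?thesis unfolding S_def K_def by simp
qed

section \<open>Arc length and curvature of a parametrized closed curve\<close>

definition quarter_turn :: "real ^ 2 \<Rightarrow> real ^ 2" where
  "quarter_turn u = vector [- (u $ 2), u $ 1]"

lemma quarter_turn_nth [simp]: "quarter_turn u $ 1 = - (u $ 2)" "quarter_turn u $ 2 = u $ 1"
  by (simp_all add: quarter_turn_def)

lemma vec2_eq_iff: "u = v \<longleftrightarrow> u $ 1 = v $ 1 \<and> u $ 2 = v $ 2" for u v :: "real ^ 2"
  by (simp add: vec_eq_iff forall_2)

lemma has_vector_derivative_vec2_iff:
  fixes f :: "real \<Rightarrow> real ^ 2"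
  shows "(f has_vector_derivative f') (at t within S) \<longleftrightarrow>
    ((\<lambda>t. f t $ 1) has_real_derivative f' $ 1) (at t within S) \<and>
    ((\<lambda>t. f t $ 2) has_real_derivative f' $ 2) (at t within S)" (is "?l \<longleftrightarrow> ?r")
proof
  assume ?l
  then show ?r
    unfolding has_real_derivative_iff_has_vector_derivative
    using bounded_linear.has_vector_derivative[OF bounded_linear_vec_nth] by blast
next
  assume r: ?r
  have eq: "v = v $ 1 *\<^sub>R (axis 1 1) + v $ 2 *\<^sub>R (axis 2 1)" for v :: "real ^ 2"
    by (simp add: vec2_eq_iff axis_def)
  have "((\<lambda>t. f t $ 1 *\<^sub>R (axis 1 1 :: real ^ 2) + f t $ 2 *\<^sub>R axis 2 1) has_vector_derivative
      f' $ 1 *\<^sub>R axis 1 1 + f' $ 2 *\<^sub>R axis 2 1) (at t within S)"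
    using r by (auto intro!: derivative_eq_intros)
  then show ?l unfolding eq[symmetric] .
qed

lemma norm_vec2_sq: "(norm u)\<^sup>2 = (u $ 1)\<^sup>2 + (u $ 2)\<^sup>2" for u :: "real ^ 2"
  by (simp add: norm_eq_sqrt_inner inner_vec_def sum_2 power2_eq_square)

lemma norm_vec2_deriv:
  fixes u :: "real \<Rightarrow> real ^ 2"
  assumes u: "(u has_vector_derivative u') (at t within S)" and "u t \<noteq> 0"
  shows "((\<lambda>t. norm (u t)) has_real_derivative (u t $ 1 * u' $ 1 + u t $ 2 * u' $ 2) / norm (u t))
    (at t within S)"
proof -
  have "((\<lambda>t. (u t $ 1)\<^sup>2 + (u t $ 2)\<^sup>2) has_real_derivative
      2 * u t $ 1 * u' $ 1 + 2 * u t $ 2 * u' $ 2) (at t within S)"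
    using u unfolding has_vector_derivative_vec2_iff by (auto intro!: derivative_eq_intros)
  moreover have "(u t $ 1)\<^sup>2 + (u t $ 2)\<^sup>2 > 0"
    using \<open>u t \<noteq> 0\<close> by (simp flip: norm_vec2_sq)
  ultimately have "((\<lambda>t. sqrt ((u t $ 1)\<^sup>2 + (u t $ 2)\<^sup>2)) has_real_derivative
      (inverse (sqrt ((u t $ 1)\<^sup>2 + (u t $ 2)\<^sup>2)) / 2) *
        (2 * u t $ 1 * u' $ 1 + 2 * u t $ 2 * u' $ 2)) (at t within S)"
    by (intro DERIV_chain2[OF DERIV_real_sqrt])
  moreover have "sqrt ((u t $ 1)\<^sup>2 + (u t $ 2)\<^sup>2) = norm (u t)" for t
    unfolding norm_vec2_sq[symmetric] by simp
  moreover have "inverse w / 2 * (2 * x1 * x2 + 2 * y1 * y2) = (x1 * x2 + y1 * y2) / w"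
    for w x1 x2 y1 y2 :: real
    by (cases "w = 0") (simp_all add: field_simps)
  ultimately show ?thesis by (simp only:)
qed

lemma has_vector_derivative_periodic:
  assumes "\<And>q :: real. f (q + 1) = f q" and "\<And>q. (f has_vector_derivative f' q) (at q)"
  shows "f' (p + 1) = f' p"
proof -
  have "((f \<circ> (\<lambda>q. q + 1)) has_vector_derivative 1 *\<^sub>R f' (p + 1)) (at p)"
    by (rule vector_diff_chain_at) (auto intro!: derivative_eq_intros assms(2))
  moreover have "f \<circ> (\<lambda>q. q + 1) = f" using assms(1) by auto
  ultimately show ?thesis
    using vector_derivative_unique_at[OF assms(2)[of p]] by auto
qed

text \<open>
  An immersed closed curve in an arbitrary parameter, with named first and second derivatives. The
  integrals over arc length in the definitions of area, rotation number and curvature energy become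
  integrals over the fixed interval \<open>{0..1}\<close>, which can be differentiated in time.
\<close>

locale C2_closed_curve =
  fixes c c1 c2 :: "real \<Rightarrow> real ^ 2"
  assumes deriv1: "(c has_vector_derivative c1 p) (at p)"
    and deriv2: "(c1 has_vector_derivative c2 p) (at p)"
    and cont2: "continuous_on UNIV c2"
    and periodic: "c (p + 1) = c p"
    and immersed: "c1 p \<noteq> 0"
begin

definition speed :: "real \<Rightarrow> real" where "speed p = norm (c1 p)"

text \<open>
  The signed curvature at a given value of the parameter \<open>p\<close>, rather than of arc length.
\<close>

definition param_curvature :: "real \<Rightarrow> real" where
  "param_curvature p = (c1 p $ 1 * c2 p $ 2 - c1 p $ 2 * c2 p $ 1) / speed p ^ 3"

lemma speed_pos: "speed p > 0" by (simp add: speed_def immersed)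

lemma speed_sq: "(speed p)\<^sup>2 = (c1 p $ 1)\<^sup>2 + (c1 p $ 2)\<^sup>2"
  by (simp add: speed_def norm_vec2_sq)

lemma vector_derivative_eq: "vector_derivative c (at p) = c1 p"
  by (rule vector_derivative_at[OF deriv1])

lemma periodic1: "c1 (p + 1) = c1 p"
  using has_vector_derivative_periodic[OF periodic deriv1] .

lemma cont0: "continuous_on S c" and cont1: "continuous_on S c1" and cont_speed: "continuous_on S speed"
proof -
  show "continuous_on S c"
    using deriv1 has_vector_derivative_continuous continuous_at_imp_continuous_on by blast
  show "continuous_on S c1"
    using deriv2 has_vector_derivative_continuous continuous_at_imp_continuous_on by blast
  then show "continuous_on S speed" unfolding speed_def[abs_def] by (intro continuous_intros)
qed

lemma component_derivs:
  "((\<lambda>p. c p $ 1) has_real_derivative c1 p $ 1) (at p within S)"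
  "((\<lambda>p. c p $ 2) has_real_derivative c1 p $ 2) (at p within S)"
  "((\<lambda>p. c1 p $ 1) has_real_derivative c2 p $ 1) (at p within S)"
  "((\<lambda>p. c1 p $ 2) has_real_derivative c2 p $ 2) (at p within S)"
  using deriv1[of p] deriv2[of p] unfolding has_vector_derivative_vec2_iff
  by (auto intro: has_field_derivative_at_within)

lemma arclength_deriv: "(arclength c has_real_derivative speed p) (at p)"
proof -
  define a where "a = \<bar>p\<bar> + 1"
  have "((\<lambda>u. LBINT q=0..u. speed q) has_vector_derivative speed p) (at p within {-a..a})"
    using interval_integral_FTC2[of "-a" 0 a speed p] cont_speed
    by (auto simp: a_def zero_ereal_def)
  moreover have "at p within {-a..a} = at p"
    by (rule at_within_Icc_at) (auto simp: a_def)
  ultimately show ?thesis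
    unfolding has_real_derivative_iff_has_vector_derivative
    by (simp add: arclength_def[abs_def] vector_derivative_eq speed_def)
qed

lemma arclength_0 [simp]: "arclength c 0 = 0"
  by (simp add: arclength_def zero_ereal_def)

lemma curve_length_eq: "curve_length c = integral {0..1} speed"
  by (simp add: curve_length_def vector_derivative_eq speed_def[abs_def])

lemma arclength_strict_mono: "p < q \<Longrightarrow> arclength c p < arclength c q"
  using DERIV_pos_imp_increasing arclength_deriv speed_pos by blast

lemma arclength_1: "arclength c 1 = curve_length c"
proof -
  have "(speed has_integral arclength c 1 - arclength c 0) {0..1}"
    using arclength_deriv
    by (intro fundamental_theorem_of_calculus)
      (auto simp: has_real_derivative_iff_has_vector_derivative[symmetric]
         intro: has_field_derivative_at_within)
  then show ?thesis by (simp add: curve_length_eq integral_unique)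
qed

lemma curve_length_pos: "curve_length c > 0"
  using arclength_strict_mono[of 0 1] arclength_1 by simp

lemma arclength_shift: "arclength c (p + 1) = arclength c p + curve_length c"
proof -
  have "((\<lambda>p. arclength c (p + 1) - arclength c p) has_real_derivative 0) (at p)" for p
  proof -
    have "((\<lambda>p. arclength c (p + 1)) has_real_derivative speed (p + 1) * 1) (at p)"
      by (rule DERIV_chain2[OF arclength_deriv]) (auto intro!: derivative_eq_intros)
    from DERIV_diff[OF this arclength_deriv[of p]] show ?thesis
      by (simp add: speed_def periodic1)
  qed
  from DERIV_isconst_all[of _ p 0, OF allI, OF this] show ?thesis by (simp add: arclength_1)
qed

text \<open>
  Arc length grows by the length of the curve over each period, hence is unbounded in both directions.
\<close>

lemma arclength_bij: "bij (arclength c)"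
proof (rule bijI)
  show "inj (arclength c)"
    by (metis arclength_strict_mono injI less_irrefl linorder_neqE_linordered_idom)
  have up: "arclength c (real n) = real n * curve_length c" for n
  proof (induction n)
    case (Suc n)
    then show ?case using arclength_shift[of "real n"] by (simp add: algebra_simps)
  qed simp
  have down: "arclength c (- real n) = - real n * curve_length c" for n
  proof (induction n)
    case (Suc n)
    then show ?case using arclength_shift[of "- real (Suc n)"] by (simp add: algebra_simps)
  qed simp
  show "surj (arclength c)"
    unfolding surj_def
  proof
    fix y
    obtain n where n: "real n * curve_length c > \<bar>y\<bar>"
      using reals_Archimedean3[OF curve_length_pos] by blast
    have "continuous_on {- real n..real n} (arclength c)"
      by (rule DERIV_continuous_on[OF has_field_derivative_at_within[OF arclength_deriv]])
    from IVT'[of "arclength c" "- real n" y "real n", OF _ _ _ this] n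
    show "\<exists>x. y = arclength c x" unfolding up down by force
  qed
qed

abbreviation param_at :: "real \<Rightarrow> real" where "param_at \<equiv> inv (arclength c)"

lemma param_at_arclength [simp]: "param_at (arclength c p) = p"
  and arclength_param_at [simp]: "arclength c (param_at s) = s"
  using arclength_bij by (simp_all add: bij_is_inj bij_is_surj surj_f_inv_f)

lemma param_at_ends [simp]: "param_at 0 = 0" "param_at (curve_length c) = 1"
  using param_at_arclength[of 0] param_at_arclength[of 1] by (simp_all add: arclength_1)

text \<open>
  The inverse of arc length is differentiable by the inverse function theorem, which makes the
  arc-length parametrization twice differentiable.
\<close>

lemma param_at_deriv: "(param_at has_real_derivative 1 / speed (param_at s)) (at s)"
proof -
  have "isCont param_at (arclength c (param_at s))"
    by (rule isCont_inverse_function[of 1]) (simp_all add: DERIV_isCont[OF arclength_deriv])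
  then show ?thesis
    using DERIV_inverse_function[of "arclength c" "speed (param_at s)" param_at s "s - 1" "s + 1"]
      arclength_deriv[of "param_at s"] speed_pos[of "param_at s"]
    by (simp add: inverse_eq_divide)
qed

lemma arclength_param_deriv:
  assumes "(g has_vector_derivative g') (at (param_at s))"
  shows "((g \<circ> param_at) has_vector_derivative (1 / speed (param_at s)) *\<^sub>R g') (at s)"
  using vector_diff_chain_at[where f = param_at, OF _ assms] param_at_deriv
  by (simp add: has_real_derivative_iff_has_vector_derivative)

lemma tangent_eq: "tangent c s = (1 / speed (param_at s)) *\<^sub>R c1 (param_at s)"
  unfolding tangent_def arclength_param_def
  by (rule vector_derivative_at[OF arclength_param_deriv[OF deriv1]])

lemma unit_normal_eq:
  "unit_normal c s = (1 / speed (param_at s)) *\<^sub>R quarter_turn (c1 (param_at s))"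
  by (simp add: unit_normal_def tangent_eq vec2_eq_iff)

lemma speed_deriv:
  "(speed has_real_derivative (c1 p $ 1 * c2 p $ 1 + c1 p $ 2 * c2 p $ 2) / speed p) (at p)"
  unfolding speed_def[abs_def] using deriv2 immersed by (rule norm_vec2_deriv)

lemma unit_tangent_deriv:
  "((\<lambda>p. (1 / speed p) *\<^sub>R c1 p) has_vector_derivative param_curvature p *\<^sub>R quarter_turn (c1 p)) (at p)"
proof -
  have v: "speed p > 0" by (rule speed_pos)
  have sq: "speed p * speed p = c1 p $ 1 * c1 p $ 1 + c1 p $ 2 * c1 p $ 2"
    using speed_sq[of p] by (simp add: power2_eq_square)
  let ?d = "(c1 p $ 1 * c2 p $ 1 + c1 p $ 2 * c2 p $ 2) / speed p"
  have quot: "(x2 * speed p - x1 * ?d) / (speed p * speed p)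
      = (x2 * (c1 p $ 1 * c1 p $ 1 + c1 p $ 2 * c1 p $ 2)
         - x1 * (c1 p $ 1 * c2 p $ 1 + c1 p $ 2 * c2 p $ 2)) / speed p ^ 3" for x1 x2
    unfolding sq[symmetric] using v by (simp add: field_simps power3_eq_cube)
  have "((\<lambda>p. c1 p $ 1 / speed p) has_real_derivative
      (c2 p $ 1 * speed p - c1 p $ 1 * ?d) / (speed p * speed p)) (at p)"
    using v by (intro DERIV_divide component_derivs speed_deriv) auto
  moreover have "((\<lambda>p. c1 p $ 2 / speed p) has_real_derivative
      (c2 p $ 2 * speed p - c1 p $ 2 * ?d) / (speed p * speed p)) (at p)"
    using v by (intro DERIV_divide component_derivs speed_deriv) auto
  ultimately show ?thesis
    unfolding has_vector_derivative_vec2_iff quot param_curvature_def by (simp add: algebra_simps)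
qed

lemma tangent_deriv:
  "(tangent c has_vector_derivative param_curvature (param_at s) *\<^sub>R unit_normal c s) (at s)"
  using arclength_param_deriv[OF unit_tangent_deriv[of "param_at s"]]
  by (simp add: tangent_eq[abs_def] o_def unit_normal_eq mult.commute)

lemma curvature_vector_eq: "curvature_vector c s = param_curvature (param_at s) *\<^sub>R unit_normal c s"
  unfolding curvature_vector_def by (rule vector_derivative_at[OF tangent_deriv])

lemma tangent_unit: "(tangent c s $ 1)\<^sup>2 + (tangent c s $ 2)\<^sup>2 = 1"
  using speed_pos[of "param_at s"]
  by (simp add: tangent_eq power_divide add_divide_distrib[symmetric] speed_sq[symmetric])

lemma curvature_eq: "curvature c s = param_curvature (param_at s)"
proof -
  have "unit_normal c s \<bullet> unit_normal c s = 1"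
    using tangent_unit[of s] by (simp add: unit_normal_def inner_vec_def sum_2 power2_eq_square)
  then show ?thesis by (simp add: curvature_def curvature_vector_eq)
qed

lemma cont_param_curvature: "continuous_on S param_curvature"
proof -
  have "continuous_on S c2" by (rule continuous_on_subset[OF cont2]) simp
  moreover have "speed p ^ 3 \<noteq> 0" for p using speed_pos[of p] by simp
  ultimately show ?thesis
    unfolding param_curvature_def by (intro continuous_intros cont1 cont_speed) simp_all
qed

lemma cont_param_at: "continuous_on S param_at"
  by (rule DERIV_continuous_on[OF has_field_derivative_at_within[OF param_at_deriv]])

text \<open>
  Substitution \<open>s = arclength c p\<close>, \<open>ds = speed p dp\<close>.
\<close>

lemma integral_arclength:
  assumes "continuous_on UNIV g"
  shows "integral {0..curve_length c} (\<lambda>s. g (param_at s)) = integral {0..1} (\<lambda>p. g p * speed p)"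
proof -
  have "((\<lambda>p. speed p *\<^sub>R g (param_at (arclength c p))) has_integral
      integral {arclength c 0..arclength c 1} (\<lambda>s. g (param_at s))) {0..1}"
  proof (rule has_integral_substitution[where c = 0 and d = "curve_length c"])
    show "arclength c ` {0..1} \<subseteq> {0..curve_length c}"
      using arclength_strict_mono[of 0] arclength_strict_mono[of _ 1]
      using curve_length_pos by (auto simp: arclength_1 less_eq_real_def)
    show "continuous_on {0..curve_length c} (\<lambda>s. g (param_at s))"
      by (rule continuous_on_compose2[OF assms cont_param_at]) simp
  qed (use curve_length_pos in \<open>auto simp: arclength_1 has_field_derivative_at_within[OF arclength_deriv]\<close>)
  then show ?thesis by (simp add: arclength_1 integral_unique mult.commute)
qed

lemma signed_area_eq:
  "signed_area c = integral {0..1} (\<lambda>p. c p $ 1 * c1 p $ 2 - c p $ 2 * c1 p $ 1) / 2"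
proof -
  have "speed p \<noteq> 0" for p using speed_pos[of p] by simp
  note nz = this
  define g where "g p = (c p $ 1 * c1 p $ 2 - c p $ 2 * c1 p $ 1) / speed p" for p
  have cont: "continuous_on UNIV g"
    unfolding g_def by (intro continuous_intros cont0 cont1 cont_speed) (simp add: nz)
  have "arclength_param c s \<bullet> unit_normal c s = - g (param_at s)" for s
    by (simp add: g_def arclength_param_def unit_normal_eq inner_vec_def sum_2 diff_divide_distrib)
  then have "signed_area c = integral {0..1} (\<lambda>p. g p * speed p) / 2"
    by (simp add: signed_area_def integral_arclength[OF cont])
  moreover have "g p * speed p = c p $ 1 * c1 p $ 2 - c p $ 2 * c1 p $ 1" for p
    using speed_pos[of p] by (simp add: g_def)
  ultimately show ?thesis by simp
qed

lemma rotation_number_eq: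
  "rotation_number c = integral {0..1} (\<lambda>p. param_curvature p * speed p) / (2 * pi)"
  unfolding rotation_number_def
  by (simp add: curvature_eq[abs_def] integral_arclength[OF cont_param_curvature])

lemma arclength_param_components:
  "((\<lambda>s. arclength_param c s $ 1) has_real_derivative tangent c s $ 1) (at s within S)"
  "((\<lambda>s. arclength_param c s $ 2) has_real_derivative tangent c s $ 2) (at s within S)"
  "((\<lambda>s. tangent c s $ 1) has_real_derivative - curvature c s * tangent c s $ 2) (at s within S)"
  "((\<lambda>s. tangent c s $ 2) has_real_derivative curvature c s * tangent c s $ 1) (at s within S)"
proof -
  have "(arclength_param c has_vector_derivative tangent c s) (at s)"
    unfolding arclength_param_def tangent_eq by (rule arclength_param_deriv[OF deriv1])
  then show "((\<lambda>s. arclength_param c s $ 1) has_real_derivative tangent c s $ 1) (at s within S)"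
    "((\<lambda>s. arclength_param c s $ 2) has_real_derivative tangent c s $ 2) (at s within S)"
    unfolding has_vector_derivative_vec2_iff by (auto intro: has_field_derivative_at_within)
  show "((\<lambda>s. tangent c s $ 1) has_real_derivative - curvature c s * tangent c s $ 2) (at s within S)"
    "((\<lambda>s. tangent c s $ 2) has_real_derivative curvature c s * tangent c s $ 1) (at s within S)"
    using tangent_deriv[of s] unfolding has_vector_derivative_vec2_iff
    by (auto intro: has_field_derivative_at_within simp: curvature_eq unit_normal_def)
qed

lemma closed_ends:
  "arclength_param c (curve_length c) = arclength_param c 0"
  "tangent c (curve_length c) = tangent c 0"
  using periodic[of 0] periodic1[of 0] by (simp_all add: arclength_param_def tangent_eq speed_def)

lemma signed_area_arclength: "2 * signed_area c = integral {0..curve_length c}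
   (\<lambda>s. arclength_param c s $ 1 * tangent c s $ 2 - arclength_param c s $ 2 * tangent c s $ 1)"
proof -
  have "arclength_param c s \<bullet> unit_normal c s = - (arclength_param c s $ 1 * tangent c s $ 2
      - arclength_param c s $ 2 * tangent c s $ 1)" for s
    by (simp add: unit_normal_def inner_vec_def sum_2)
  then show ?thesis unfolding signed_area_def by (simp only: integral_neg)
qed

lemma cont_tangent: "continuous_on S (\<lambda>s. tangent c s $ i)"
proof -
  have "continuous_on S (tangent c)"
    using tangent_deriv has_vector_derivative_continuous continuous_at_imp_continuous_on by blast
  then show ?thesis by (intro continuous_intros)
qed

theorem isoperimetric_deficit_nonneg: "0 \<le> isoperimetric_deficit c"
proof -
  have "\<bar>2 * pi / curve_length c * (2 * signed_area c)\<bar> \<le> integral {0..curve_length c}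
      (\<lambda>s. (tangent c s $ 1)\<^sup>2 + (tangent c s $ 2)\<^sup>2)"
    unfolding signed_area_arclength
    by (intro area_form_le_energy curve_length_pos arclength_param_components cont_tangent)
      (simp_all add: closed_ends)
  also have "\<dots> = curve_length c" using curve_length_pos by (simp add: tangent_unit)
  finally have "2 * pi / curve_length c * (2 * signed_area c) \<le> curve_length c" by linarith
  then show ?thesis
    using curve_length_pos by (simp add: isoperimetric_deficit_def field_simps power2_eq_square)
qed

theorem isoperimetric_deficit_le_curvature_energy:
  assumes "rotation_number c = 1"
  shows "2 * pi\<^sup>2 * isoperimetric_deficit c
    \<le> curve_length c * integral {0..1} (\<lambda>p. (param_curvature p)\<^sup>2 * speed p) - 4 * pi\<^sup>2"
proof -
  have cont: "continuous_on S (curvature c)" for S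
    unfolding curvature_eq[abs_def]
    by (rule continuous_on_compose2[OF cont_param_curvature[of UNIV] cont_param_at]) simp
  have total: "integral {0..curve_length c} (curvature c) = 2 * pi"
    using assms by (simp add: rotation_number_def)
  have "2 * pi\<^sup>2 * (1 - 2 * pi * (2 * signed_area c) / (curve_length c)\<^sup>2)
      \<le> curve_length c * integral {0..curve_length c} (\<lambda>s. (curvature c s)\<^sup>2) - 4 * pi\<^sup>2"
    unfolding signed_area_arclength
    by (intro deficit_le_curvature_energy curve_length_pos arclength_param_components cont
        tangent_unit total) (simp_all add: closed_ends)
  moreover have "integral {0..curve_length c} (\<lambda>s. (curvature c s)\<^sup>2)
      = integral {0..1} (\<lambda>p. (param_curvature p)\<^sup>2 * speed p)"
    unfolding curvature_eq by (intro integral_arclength continuous_intros cont_param_curvature)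
  ultimately show ?thesis by (simp add: isoperimetric_deficit_def mult.assoc)
qed

end

section \<open>A differential inequality for the isoperimetric deficit\<close>

text \<open>
  Monotonicity from the sign of a derivative that is one-sided at the initial time.
\<close>

lemma antimono_on_half_line:
  fixes f f' :: "real \<Rightarrow> real"
  assumes f: "\<And>t. t \<ge> 0 \<Longrightarrow> (f has_real_derivative f' t) (at t within {0..})"
    and "\<And>t. t \<ge> 0 \<Longrightarrow> f' t \<le> 0"
    and "0 \<le> s" "s \<le> t"
  shows "f t \<le> f s"
proof -
  have 1: "(f' has_integral (f t - f s)) {s..t}"
    using assms by (intro fundamental_theorem_of_calculus)
      (auto simp: has_real_derivative_iff_has_vector_derivative[symmetric] intro!: DERIV_subset[OF f])
  have "f t - f s \<le> 0"
    by (rule has_integral_le[OF 1 has_integral_0]) (use assms in auto)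
  then show ?thesis by simp
qed

text \<open>
  This is the analytic core of the convergence: the geometry enters only through the evolution of \<open>A\<close>
  and \<open>L\<close> and the two-sided estimate for \<open>I\<close>. The difficulty is that the decay rate \<open>a / A\<close> of \<open>I\<close>
  degenerates if \<open>A\<close> is unbounded. But \<open>A\<close> grows only while \<open>I\<close> is positive, and the
  total growth of \<open>ln A\<close> is at most a multiple of \<open>I 0\<close>.
\<close>

lemma deficit_ode_convergence:
  fixes A L K I :: "real \<Rightarrow> real"
  assumes A: "\<And>t. t \<ge> 0 \<Longrightarrow>
      (A has_real_derivative (L t)\<^sup>2 / (2 * A t) - 2 * pi) (at t within {0..})"
    and L: "\<And>t. t \<ge> 0 \<Longrightarrow> (L has_real_derivative pi * L t / A t - K t) (at t within {0..})"
    and A_nz: "\<And>t. t \<ge> 0 \<Longrightarrow> A t \<noteq> 0"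
    and A_init: "A 0 > 0"
    and L_pos: "\<And>t. t \<ge> 0 \<Longrightarrow> L t > 0"
    and I_def: "\<And>t. I t = 1 - 4 * pi * A t / (L t)\<^sup>2"
    and I_nonneg: "\<And>t. t \<ge> 0 \<Longrightarrow> 0 \<le> I t"
    and K: "\<And>t. t \<ge> 0 \<Longrightarrow> 2 * pi\<^sup>2 * I t \<le> L t * K t - 4 * pi\<^sup>2"
  shows "(\<exists>C>0. \<exists>r>0. \<forall>t\<ge>0. 0 \<le> I t \<and> I t \<le> C * exp (- r * t)) \<and>
    (\<exists>A_inf>0. \<exists>L_inf>0.
       (A \<longlongrightarrow> A_inf) at_top \<and> (L \<longlongrightarrow> L_inf) at_top \<and>
       4 * pi * A_inf = L_inf\<^sup>2 \<and>
       (\<exists>C>0. \<exists>r>0. \<forall>t\<ge>0.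
          0 \<le> A_inf - A t \<and> A_inf - A t \<le> C * exp (- r * t) \<and>
          \<bar>L t - L_inf\<bar> \<le> C * exp (- r * t)))"
proof -
  have A_pos: "A t > 0" if "t \<ge> 0" for t
  proof (rule ccontr)
    assume "\<not> A t > 0"
    moreover have "continuous_on {0..t} A"
      by (rule continuous_on_subset[OF DERIV_continuous_on[of "{0..}" A]]) (use A in auto)
    ultimately obtain s where "0 \<le> s" "A s = 0"
      using IVT2'[of A t 0 0] A_init \<open>t \<ge> 0\<close> by (auto simp: not_less)
    then show False using A_nz by auto
  qed
  have I_less: "I t < 1" if "t \<ge> 0" for t
    using A_pos[OF that] L_pos[OF that] by (simp add: I_def)
  have L_sq: "(L t)\<^sup>2 * (1 - I t) = 4 * pi * A t" if "t \<ge> 0" for t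
    using L_pos[OF that] by (simp add: I_def)
  have A_rate: "(L t)\<^sup>2 / (2 * A t) - 2 * pi = 2 * pi * I t / (1 - I t)" if "t \<ge> 0" for t
  proof -
    have "(L t)\<^sup>2 = 4 * pi * A t / (1 - I t)"
      using L_sq[OF that] I_less[OF that] by (simp add: field_simps)
    then show ?thesis using I_less[OF that] A_pos[OF that] by (simp add: field_simps)
  qed
  define I' where "I' t = - (4 * pi * (((L t)\<^sup>2 / (2 * A t) - 2 * pi) * (L t)\<^sup>2
      - A t * (2 * L t * (pi * L t / A t - K t))) / ((L t)\<^sup>2 * (L t)\<^sup>2))" for t
  have I_deriv: "(I has_real_derivative I' t) (at t within {0..})" if "t \<ge> 0" for t
  proof -
    have "((\<lambda>t. 1 - 4 * pi * A t / (L t)\<^sup>2) has_real_derivative I' t) (at t within {0..})"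
      using L_pos[OF that] unfolding I'_def
      by (auto intro!: derivative_eq_intros A L that simp: algebra_simps)
    then show ?thesis by (simp add: I_def[abs_def])
  qed
  have I'_bound: "I' t \<le> - (pi * (1 - I t)\<^sup>2 / A t) * I t" if "t \<ge> 0" for t
  proof -
    have p: "A t > 0" "L t > 0" using A_pos L_pos that by auto
    have "I' t = - (2 * pi / A t) * (I t)\<^sup>2 - (8 * pi * A t / (L t)^4) * (L t * K t - 4 * pi\<^sup>2)"
      using p unfolding I'_def I_def
      by (simp add: field_simps power2_eq_square power4_eq_xxxx)
    also have "\<dots> \<le> 0 - (8 * pi * A t / (L t)^4) * (2 * pi\<^sup>2 * I t)"
      using p K[OF that] by (intro diff_mono mult_left_mono) auto
    also have "\<dots> = - (pi * (4 * pi * A t / (L t)\<^sup>2)\<^sup>2 / A t) * I t"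
      using p by (simp add: field_simps power2_eq_square power4_eq_xxxx)
    also have "4 * pi * A t / (L t)\<^sup>2 = 1 - I t" by (simp add: I_def)
    finally show ?thesis .
  qed
  have I_init: "I t \<le> I 0" if "t \<ge> 0" for t
  proof (rule antimono_on_half_line[OF I_deriv])
    fix t :: real assume "t \<ge> 0"
    have "0 \<le> pi * (1 - I t)\<^sup>2 / A t * I t"
      using A_pos[OF \<open>t \<ge> 0\<close>] I_nonneg[OF \<open>t \<ge> 0\<close>] by simp
    with I'_bound[OF \<open>t \<ge> 0\<close>] show "I' t \<le> 0" by simp
  qed (use that in auto)
  \<comment> \<open>As \<open>I\<close> does not increase, \<open>q\<close> is a lower bound of \<open>1 - I\<close> at all times.\<close>
  define q where "q = 1 - I 0"
  define a where "a = pi * q\<^sup>2"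
  define b where "b = 2 * pi / q"
  have q: "q > 0" "q \<le> 1 - I t" if "t \<ge> 0" for t
    using I_less[of 0] I_init[OF that] by (auto simp: q_def)
  have pos: "a > 0" "b > 0" "q > 0" using q[of 0] by (auto simp: a_def b_def)
  have I'_a: "I' t \<le> - a * I t / A t" if "t \<ge> 0" for t
  proof -
    have "a * (I t / A t) \<le> pi * (1 - I t)\<^sup>2 * (I t / A t)"
      unfolding a_def using q[OF that] A_pos[OF that] I_nonneg[OF that]
      by (intro mult_right_mono mult_left_mono power_mono) auto
    then show ?thesis using I'_bound[OF that] by simp
  qed
  have A'_b: "2 * pi * I t / (1 - I t) \<le> b * I t" if "t \<ge> 0" for t
    unfolding b_def using q[OF that] I_nonneg[OF that]
    by (simp add: frac_le)
  have A_deriv: "(A has_real_derivative 2 * pi * I t / (1 - I t)) (at t within {0..})"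
    if "t \<ge> 0" for t
    using A[OF that] A_rate[OF that] by simp
  have A_mono: "A s \<le> A t" if "0 \<le> s" "s \<le> t" for s t
  proof -
    have "- A t \<le> - A s"
      by (rule antimono_on_half_line[OF DERIV_minus[OF A_deriv]])
        (use that I_nonneg I_less in \<open>auto intro!: divide_nonneg_nonneg simp: less_imp_le\<close>)
    then show ?thesis by simp
  qed
  \<comment> \<open>The bound is the value at time \<open>0\<close> of the nonincreasing quantity \<open>ln A + (b / a) * I\<close>, exponentiated.\<close>
  define M where "M = exp (ln (A 0) + b / a * I 0)"
  have A_le: "A t \<le> M" if "t \<ge> 0" for t
  proof -
    have "ln (A t) + b / a * I t \<le> ln (A 0) + b / a * I 0"
    proof (rule antimono_on_half_line[where f = "\<lambda>t. ln (A t) + b / a * I t"])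
      fix t :: real assume t: "t \<ge> 0"
      show "((\<lambda>t. ln (A t) + b / a * I t) has_real_derivative
          2 * pi * I t / (1 - I t) / A t + b / a * I' t) (at t within {0..})"
        using A_pos[OF t] pos
        by (auto intro!: derivative_eq_intros A_deriv I_deriv t simp: mult.commute)
      have "2 * pi * I t / (1 - I t) / A t \<le> b * I t / A t"
        using A'_b[OF t] A_pos[OF t] by (intro divide_right_mono) auto
      moreover have "b / a * I' t \<le> b / a * (- a * I t / A t)"
        using I'_a[OF t] pos by (intro mult_left_mono) auto
      ultimately show "2 * pi * I t / (1 - I t) / A t + b / a * I' t \<le> 0"
        using pos by simp
    qed (use that in auto)
    moreover have "0 \<le> b / a * I t" using pos I_nonneg[OF that] by simp
    ultimately have "ln (A t) \<le> ln (A 0) + b / a * I 0" by linarith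
    then show ?thesis using A_pos[OF that] unfolding M_def by (metis exp_le_cancel_iff exp_ln)
  qed
  have M: "M > 0" by (simp add: M_def)
  define r where "r = a / M"
  have r: "r > 0" using pos M by (simp add: r_def)
  have I'_r: "I' t \<le> - r * I t" if "t \<ge> 0" for t
  proof -
    have "a * I t / M \<le> a * I t / A t"
      using A_le[OF that] A_pos[OF that] I_nonneg[OF that] pos by (intro divide_left_mono) auto
    with I'_a[OF that] show ?thesis by (simp add: r_def)
  qed
  have I_decay: "I t \<le> I 0 * exp (- r * t)" if "t \<ge> 0" for t
  proof -
    have "I t * exp (r * t) \<le> I 0 * exp (r * 0)"
    proof (rule antimono_on_half_line[where f = "\<lambda>t. I t * exp (r * t)"])
      fix t :: real assume t: "t \<ge> 0"
      show "((\<lambda>t. I t * exp (r * t)) has_real_derivative (I' t + r * I t) * exp (r * t))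
          (at t within {0..})"
        by (auto intro!: derivative_eq_intros I_deriv t simp: algebra_simps)
      show "(I' t + r * I t) * exp (r * t) \<le> 0"
        using I'_r[OF t] by (simp add: mult_nonpos_nonneg)
    qed (use that in auto)
    then show ?thesis by (simp add: exp_minus field_simps)
  qed
  \<comment> \<open>The same comparison, now with the uniform rate, controls how far \<open>A\<close> can still grow after time \<open>s\<close>.\<close>
  have A_I: "A t + b / r * I t \<le> A s + b / r * I s" if "0 \<le> s" "s \<le> t" for s t
  proof (rule antimono_on_half_line[where f = "\<lambda>t. A t + b / r * I t"])
    fix t :: real assume t: "t \<ge> 0"
    show "((\<lambda>t. A t + b / r * I t) has_real_derivative
        2 * pi * I t / (1 - I t) + b / r * I' t) (at t within {0..})"
      using r by (auto intro!: derivative_eq_intros A_deriv I_deriv t)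
    have "b / r * I' t \<le> b / r * (- r * I t)"
      using I'_r[OF t] pos r by (intro mult_left_mono) auto
    then show "2 * pi * I t / (1 - I t) + b / r * I' t \<le> 0"
      using A'_b[OF t] r by simp
  qed (use that in auto)
  define A_inf where "A_inf = (SUP t\<in>{0..}. A t)"
  have bdd: "bdd_above (A ` {0..})" using A_le by (auto intro!: bdd_aboveI2)
  have A_upper: "A t \<le> A_inf" if "t \<ge> 0" for t
    unfolding A_inf_def using that by (intro cSUP_upper bdd) auto
  have A_gap: "A_inf - A t \<le> b / r * I t" if "t \<ge> 0" for t
  proof -
    have "A_inf \<le> A t + b / r * I t"
      unfolding A_inf_def
    proof (rule cSUP_least)
      fix s :: real assume "s \<in> {0..}"
      have "A s \<le> A (max s t)" using \<open>s \<in> {0..}\<close> by (intro A_mono) auto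
      also have "\<dots> \<le> A (max s t) + b / r * I (max s t)"
        using I_nonneg[of "max s t"] pos r that by simp
      also have "\<dots> \<le> A t + b / r * I t" using that by (intro A_I) auto
      finally show "A s \<le> A t + b / r * I t" .
    qed auto
    then show ?thesis by simp
  qed
  have A_inf_pos: "A_inf > 0" using A_upper[of 0] A_init by simp
  define L_inf where "L_inf = sqrt (4 * pi * A_inf)"
  have L_inf: "L_inf > 0" "L_inf\<^sup>2 = 4 * pi * A_inf" using A_inf_pos by (auto simp: L_inf_def)
  define D where "D = 4 * pi * M / q + 4 * pi * (b / r)"
  have D: "D > 0" unfolding D_def using M pos r by (intro add_pos_pos) auto
  have L_gap: "\<bar>L t - L_inf\<bar> \<le> D / L_inf * I t" if t: "t \<ge> 0" for t
  proof -
    have "(L t)\<^sup>2 - 4 * pi * A t = 4 * pi * A t * I t / (1 - I t)"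
      using L_sq[OF t] I_less[OF t] by (simp add: field_simps)
    moreover have "\<dots> \<le> 4 * pi * M * I t / q"
      using q[OF t] A_le[OF t] A_pos[OF t] I_nonneg[OF t] M
      by (intro frac_le mult_right_mono mult_left_mono) auto
    moreover have "0 \<le> 4 * pi * A t * I t / (1 - I t)"
      using A_pos[OF t] I_nonneg[OF t] I_less[OF t] by simp
    moreover have "4 * pi * (A_inf - A t) \<le> 4 * pi * (b / r * I t)"
      using A_gap[OF t] by (intro mult_left_mono) auto
    moreover have "4 * pi * (A_inf - A t) \<ge> 0" using A_upper[OF t] by simp
    moreover have "(L t)\<^sup>2 - L_inf\<^sup>2 = ((L t)\<^sup>2 - 4 * pi * A t) - 4 * pi * (A_inf - A t)"
      by (simp add: L_inf algebra_simps)
    ultimately have "\<bar>(L t)\<^sup>2 - L_inf\<^sup>2\<bar> \<le> 4 * pi * M * I t / q + 4 * pi * (b / r * I t)"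
      by (simp only: abs_le_iff) linarith
    also have "\<dots> = D * I t" by (simp add: D_def algebra_simps)
    finally have *: "\<bar>(L t)\<^sup>2 - L_inf\<^sup>2\<bar> \<le> D * I t" .
    have "\<bar>L t - L_inf\<bar> * L_inf \<le> \<bar>L t - L_inf\<bar> * (L t + L_inf)"
      using L_pos[OF t] by (intro mult_left_mono) auto
    also have "\<dots> = \<bar>(L t)\<^sup>2 - L_inf\<^sup>2\<bar>"
    proof -
      have "(L t)\<^sup>2 - L_inf\<^sup>2 = (L t - L_inf) * (L t + L_inf)"
        by (simp add: power2_eq_square algebra_simps)
      then show ?thesis using L_pos[OF t] L_inf(1) by (simp only: abs_mult)
    qed
    finally show ?thesis using * L_inf by (simp add: field_simps)
  qed
  have lim: "((\<lambda>t. k * exp (- r * t)) \<longlongrightarrow> 0) at_top" for k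
  proof -
    have "LIM t at_top. - r * t :> at_bot"
      by (rule filterlim_tendsto_neg_mult_at_bot[OF tendsto_const _ filterlim_ident]) (use r in simp)
    then have "((\<lambda>t. exp (- r * t)) \<longlongrightarrow> 0) at_top"
      by (rule filterlim_compose[OF exp_at_bot])
    then show ?thesis by (rule tendsto_mult_right_zero)
  qed
  define C where "C = (b / r + D / L_inf) * I 0 + 1"
  have "0 \<le> b / r * I 0" "0 \<le> D / L_inf * I 0"
    using I_nonneg[of 0] pos r D L_inf by simp_all
  then have C: "C > 0" and C_A: "b / r * I 0 \<le> C" and C_L: "D / L_inf * I 0 \<le> C"
    unfolding C_def distrib_right by linarith+
  have bound: "k * I t \<le> C * exp (- r * t)" if "k * I 0 \<le> C" "k \<ge> 0" "t \<ge> 0" for k t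
  proof -
    have "k * I t \<le> k * (I 0 * exp (- r * t))" using I_decay that by (intro mult_left_mono) auto
    also have "\<dots> = (k * I 0) * exp (- r * t)" by simp
    also have "\<dots> \<le> C * exp (- r * t)" using that by (intro mult_right_mono) auto
    finally show ?thesis .
  qed
  have A_exp: "A_inf - A t \<le> C * exp (- r * t)" if "t \<ge> 0" for t
    using A_gap[OF that] bound[OF C_A _ that] pos r by force
  have L_exp: "\<bar>L t - L_inf\<bar> \<le> C * exp (- r * t)" if "t \<ge> 0" for t
    using L_gap[OF that] bound[OF C_L _ that] D L_inf by force
  have "((\<lambda>t. A t - A_inf) \<longlongrightarrow> 0) at_top"
    by (rule Lim_null_comparison[OF _ lim[of C]])
      (use A_exp A_upper in \<open>auto intro!: eventually_at_top_linorderI[of 0]\<close>)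
  then have A_lim: "(A \<longlongrightarrow> A_inf) at_top" by (simp add: LIM_zero_iff)
  have "((\<lambda>t. L t - L_inf) \<longlongrightarrow> 0) at_top"
    by (rule Lim_null_comparison[OF _ lim[of C]])
      (use L_exp in \<open>auto intro!: eventually_at_top_linorderI[of 0]\<close>)
  then have L_lim: "(L \<longlongrightarrow> L_inf) at_top" by (simp add: LIM_zero_iff)
  have "I t \<le> (I 0 + 1) * exp (- r * t)" if "t \<ge> 0" for t
    using I_decay[OF that] by (simp add: distrib_right add_increasing2)
  then have I_exp: "\<forall>t\<ge>0. 0 \<le> I t \<and> I t \<le> (I 0 + 1) * exp (- r * t)"
    using I_nonneg by simp
  have AL_exp: "\<forall>t\<ge>0. 0 \<le> A_inf - A t \<and> A_inf - A t \<le> C * exp (- r * t) \<and>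
      \<bar>L t - L_inf\<bar> \<le> C * exp (- r * t)"
    using A_exp L_exp A_upper by simp
  have "I 0 + 1 > 0" using I_nonneg[of 0] by simp
  show ?thesis
  proof (rule conjI)
    show "\<exists>C>0. \<exists>r>0. \<forall>t\<ge>0. 0 \<le> I t \<and> I t \<le> C * exp (- r * t)"
      using I_exp r \<open>I 0 + 1 > 0\<close> by blast
    have "\<exists>C>0. \<exists>r>0. \<forall>t\<ge>0. 0 \<le> A_inf - A t \<and> A_inf - A t \<le> C * exp (- r * t) \<and>
        \<bar>L t - L_inf\<bar> \<le> C * exp (- r * t)"
      using AL_exp r C by blast
    with A_lim L_lim A_inf_pos L_inf(1) L_inf(2)[symmetric]
    show "\<exists>A_inf>0. \<exists>L_inf>0.
       (A \<longlongrightarrow> A_inf) at_top \<and> (L \<longlongrightarrow> L_inf) at_top \<and>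
       4 * pi * A_inf = L_inf\<^sup>2 \<and>
       (\<exists>C>0. \<exists>r>0. \<forall>t\<ge>0.
          0 \<le> A_inf - A t \<and> A_inf - A t \<le> C * exp (- r * t) \<and>
          \<bar>L t - L_inf\<bar> \<le> C * exp (- r * t))"
      by blast
  qed
qed

section \<open>First variation of length, area and total curvature\<close>

lemma leibniz_half_line:
  fixes g g' :: "real \<Rightarrow> real \<Rightarrow> real"
  assumes deriv: "\<And>p t. t \<ge> 0 \<Longrightarrow> ((\<lambda>t. g p t) has_real_derivative g' p t) (at t within {0..})"
    and cont: "continuous_on (UNIV \<times> {0..}) (\<lambda>z. g (fst z) (snd z))"
    and cont': "continuous_on (UNIV \<times> {0..}) (\<lambda>z. g' (fst z) (snd z))"
    and "t \<ge> 0"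
  shows "((\<lambda>t. integral {0..1} (\<lambda>p. g p t)) has_real_derivative integral {0..1} (\<lambda>p. g' p t))
    (at t within {0..})"
proof -
  have "((\<lambda>t. integral (cbox 0 1) (\<lambda>p. g p t)) has_real_derivative
      integral (cbox 0 1) (\<lambda>p. g' p t)) (at t within {0..})"
  proof (rule leibniz_rule_field_derivative)
    show "((\<lambda>t. g p t) has_real_derivative g' p t) (at t within {0..})" if "t \<in> {0..}" for t p
      using deriv that by simp
    show "(\<lambda>p. g p t) integrable_on cbox 0 1" if "t \<in> {0..}" for t
      using that
      by (intro integrable_continuous continuous_on_compose2[OF cont, of _ "\<lambda>p. (p, t)", simplified]
          continuous_intros) auto
    show "continuous_on ({0..} \<times> cbox 0 1) (\<lambda>(t, p). g' p t)"
      unfolding split_beta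
      by (intro continuous_on_compose2[OF cont', of _ "\<lambda>z. (snd z, fst z)", simplified]
          continuous_intros) auto
  qed (use \<open>t \<ge> 0\<close> in auto)
  then show ?thesis by simp
qed

text \<open>
  Derivatives relative to the half line are unique, also the one-sided ones at time \<open>0\<close>.
\<close>

lemma at_within_half_line_nontrivial:
  fixes t :: real
  assumes "t \<ge> 0"
  shows "at t within {0..} \<noteq> bot"
proof -
  have "at_right t \<le> at t within {0..}" by (rule at_le) (use assms in auto)
  then show ?thesis using trivial_limit_at_right_real[of t] by (metis bot.extremum_uniqueI)
qed

text \<open>
  A moving curve \<open>f\<close> with exactly those partial derivatives that the first variation formulas involve;
  a suffix lists the differentiations. That \<open>fpt\<close> and \<open>fppt\<close> occur both as time and as parameter derivatives
  expresses the symmetry of mixed derivatives.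
\<close>

locale smooth_curve_family =
  fixes f fp fpp ft fpt fppt :: "real \<Rightarrow> real \<Rightarrow> real ^ 2"
  assumes cont: "continuous_on (UNIV \<times> {0..}) (\<lambda>z. f (fst z) (snd z))"
      "continuous_on (UNIV \<times> {0..}) (\<lambda>z. fp (fst z) (snd z))"
      "continuous_on (UNIV \<times> {0..}) (\<lambda>z. fpp (fst z) (snd z))"
      "continuous_on (UNIV \<times> {0..}) (\<lambda>z. ft (fst z) (snd z))"
      "continuous_on (UNIV \<times> {0..}) (\<lambda>z. fpt (fst z) (snd z))"
      "continuous_on (UNIV \<times> {0..}) (\<lambda>z. fppt (fst z) (snd z))"
    and deriv_p: "t \<ge> 0 \<Longrightarrow> ((\<lambda>q. f q t) has_vector_derivative fp p t) (at p)"
      "t \<ge> 0 \<Longrightarrow> ((\<lambda>q. fp q t) has_vector_derivative fpp p t) (at p)"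
      "t \<ge> 0 \<Longrightarrow> ((\<lambda>q. ft q t) has_vector_derivative fpt p t) (at p)"
      "t \<ge> 0 \<Longrightarrow> ((\<lambda>q. fpt q t) has_vector_derivative fppt p t) (at p)"
    and deriv_t: "t \<ge> 0 \<Longrightarrow> ((\<lambda>\<tau>. f p \<tau>) has_vector_derivative ft p t) (at t within {0..})"
      "t \<ge> 0 \<Longrightarrow> ((\<lambda>\<tau>. fp p \<tau>) has_vector_derivative fpt p t) (at t within {0..})"
      "t \<ge> 0 \<Longrightarrow> ((\<lambda>\<tau>. fpp p \<tau>) has_vector_derivative fppt p t) (at t within {0..})"
    and periodic: "t \<ge> 0 \<Longrightarrow> f (p + 1) t = f p t"
    and immersed: "t \<ge> 0 \<Longrightarrow> fp p t \<noteq> 0"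
begin

lemmas component_deriv_p =
  deriv_p[unfolded has_vector_derivative_vec2_iff, THEN conjunct1, THEN has_field_derivative_at_within]
  deriv_p[unfolded has_vector_derivative_vec2_iff, THEN conjunct2, THEN has_field_derivative_at_within]

lemmas component_deriv_t =
  deriv_t[unfolded has_vector_derivative_vec2_iff, THEN conjunct1]
  deriv_t[unfolded has_vector_derivative_vec2_iff, THEN conjunct2]

lemma fp_periodic: "t \<ge> 0 \<Longrightarrow> fp (p + 1) t = fp p t"
  using has_vector_derivative_periodic[of "\<lambda>q. f q t" "\<lambda>q. fp q t"] periodic deriv_p(1) by simp

lemma ft_periodic:
  assumes "t \<ge> 0"
  shows "ft (p + 1) t = ft p t"
proof -
  have "((\<lambda>\<tau>. f p \<tau>) has_vector_derivative ft (p + 1) t) (at t within {0..})"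
    using has_vector_derivative_transform[OF _ _ deriv_t(1)[OF assms, of "p + 1"],
        of "\<lambda>\<tau>. f p \<tau>"] assms periodic by simp
  with deriv_t(1)[OF assms, of p] show ?thesis
    using vector_derivative_unique_within[OF at_within_half_line_nontrivial[OF assms]] by metis
qed

lemma fpt_periodic: "t \<ge> 0 \<Longrightarrow> fpt (p + 1) t = fpt p t"
  using has_vector_derivative_periodic[of "\<lambda>q. ft q t" "\<lambda>q. fpt q t"] ft_periodic deriv_p(3) by simp

lemma C2_closed_curve:
  assumes "t \<ge> 0"
  shows "C2_closed_curve (\<lambda>p. f p t) (\<lambda>p. fp p t) (\<lambda>p. fpp p t)"
proof
  show "continuous_on UNIV (\<lambda>p. fpp p t)"
    using assms
    by (intro continuous_on_compose2[OF cont(3), of _ "\<lambda>p. (p, t)", simplified] continuous_intros) auto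
qed (use assms deriv_p periodic immersed in auto)

lemma cont_slice:
  assumes "t \<ge> 0"
  shows "continuous_on S (\<lambda>p. f p t)" "continuous_on S (\<lambda>p. fp p t)" "continuous_on S (\<lambda>p. ft p t)"
    "continuous_on S (\<lambda>p. fpt p t)"
  using assms
  by (auto intro!: continuous_on_compose2[OF cont(1), of _ "\<lambda>p. (p, t)", simplified]
    continuous_on_compose2[OF cont(2), of _ "\<lambda>p. (p, t)", simplified]
    continuous_on_compose2[OF cont(4), of _ "\<lambda>p. (p, t)", simplified]
    continuous_on_compose2[OF cont(5), of _ "\<lambda>p. (p, t)", simplified] continuous_intros)

text \<open>
  The speed \<open>v\<close> and the signed curvature \<open>k\<close> at parameter \<open>p\<close> and time \<open>t\<close>.
\<close>

definition v :: "real \<Rightarrow> real \<Rightarrow> real" where "v p t = norm (fp p t)"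

definition k :: "real \<Rightarrow> real \<Rightarrow> real" where
  "k p t = (fp p t $ 1 * fpp p t $ 2 - fp p t $ 2 * fpp p t $ 1) / v p t ^ 3"

lemma v_pos: "t \<ge> 0 \<Longrightarrow> v p t > 0" by (simp add: v_def immersed)

lemma v_sq: "(v p t)\<^sup>2 = (fp p t $ 1)\<^sup>2 + (fp p t $ 2)\<^sup>2"
  by (simp add: v_def norm_vec2_sq)

lemma speed_eq: "t \<ge> 0 \<Longrightarrow> C2_closed_curve.speed (\<lambda>p. fp p t) = (\<lambda>p. v p t)"
  by (auto simp: C2_closed_curve.speed_def[OF C2_closed_curve] v_def)

lemma param_curvature_eq:
  "t \<ge> 0 \<Longrightarrow> C2_closed_curve.param_curvature (\<lambda>p. fp p t) (\<lambda>p. fpp p t) = (\<lambda>p. k p t)"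
  by (auto simp: C2_closed_curve.param_curvature_def[OF C2_closed_curve] k_def speed_eq)

lemma v_deriv_t:
  assumes "t \<ge> 0"
  shows "((\<lambda>t. v p t) has_real_derivative
    (fp p t $ 1 * fpt p t $ 1 + fp p t $ 2 * fpt p t $ 2) / v p t) (at t within {0..})"
  unfolding v_def using deriv_t(2) immersed assms by (intro norm_vec2_deriv)

lemma cont_v [continuous_intros]: "continuous_on (UNIV \<times> {0..}) (\<lambda>z. v (fst z) (snd z))"
  unfolding v_def by (intro continuous_intros cont)

text \<open>
  The velocity is orthogonal to \<open>fp\<close> along the whole curve. Differentiating this identity in the parameter moves
  the derivative from the velocity to \<open>fp\<close>, where it
  produces the curvature: the speed satisfies \<open>v\<^sub>t = - V * k * v\<close> pointwise.
\<close>

lemma length_deriv: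
  assumes normal: "\<And>p t. t \<ge> 0 \<Longrightarrow> ft p t = (V p t / v p t) *\<^sub>R quarter_turn (fp p t)"
    and t: "t \<ge> 0"
  shows "((\<lambda>t. curve_length (\<lambda>p. f p t)) has_real_derivative
    - integral {0..1} (\<lambda>p. V p t * k p t * v p t)) (at t within {0..})"
proof -
  have "((\<lambda>t. integral {0..1} (\<lambda>p. v p t)) has_real_derivative integral {0..1}
      (\<lambda>p. (fp p t $ 1 * fpt p t $ 1 + fp p t $ 2 * fpt p t $ 2) / v p t)) (at t within {0..})"
    by (intro leibniz_half_line[OF v_deriv_t] t continuous_intros cont)
      (auto simp: less_imp_neq[OF v_pos, symmetric])
  moreover have "(fp p t $ 1 * fpt p t $ 1 + fp p t $ 2 * fpt p t $ 2) / v p t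
      = - (V p t * k p t * v p t)" for p
  proof -
    have "fp q t $ 1 * ft q t $ 1 + fp q t $ 2 * ft q t $ 2 = 0" for q
      by (simp add: normal[OF t])
    moreover have "((\<lambda>q. fp q t $ 1 * ft q t $ 1 + fp q t $ 2 * ft q t $ 2)
        has_real_derivative
        (fpp p t $ 1 * ft p t $ 1 + fpt p t $ 1 * fp p t $ 1
         + (fpp p t $ 2 * ft p t $ 2 + fpt p t $ 2 * fp p t $ 2))) (at p)"
      by (intro DERIV_add DERIV_mult component_deriv_p t)
    ultimately have "fp p t $ 1 * fpt p t $ 1 + fp p t $ 2 * fpt p t $ 2
        = - (fpp p t $ 1 * ft p t $ 1 + fpp p t $ 2 * ft p t $ 2)"
      using DERIV_unique[OF _ DERIV_const[of 0]] by (simp add: algebra_simps eq_neg_iff_add_eq_0)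
    also have "\<dots> = - (V p t * k p t * (v p t)\<^sup>2)"
      using v_pos[OF t, of p]
      by (simp add: normal[OF t] k_def field_simps power2_eq_square power3_eq_cube)
    finally show ?thesis using v_pos[OF t, of p] by (simp add: power2_eq_square)
  qed
  ultimately have "((\<lambda>t. integral {0..1} (\<lambda>p. v p t)) has_real_derivative
      - integral {0..1} (\<lambda>p. V p t * k p t * v p t)) (at t within {0..})"
    by simp
  then show ?thesis
    by (rule has_field_derivative_transform_within[OF _ zero_less_one])
      (use t in \<open>auto simp: C2_closed_curve.curve_length_eq[OF C2_closed_curve] speed_eq\<close>)
qed

text \<open>
  Up to a derivative in the parameter, which integrates to zero over the closed curve, the time derivative of the area
  integrand is twice the cross product of \<open>ft\<close> and \<open>fp\<close>.
\<close>

lemma area_deriv: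
  assumes normal: "\<And>p t. t \<ge> 0 \<Longrightarrow> ft p t = (V p t / v p t) *\<^sub>R quarter_turn (fp p t)"
    and t: "t \<ge> 0"
  shows "((\<lambda>t. signed_area (\<lambda>p. f p t)) has_real_derivative
    - integral {0..1} (\<lambda>p. V p t * v p t)) (at t within {0..})"
proof -
  define G where "G p = ft p t $ 1 * fp p t $ 2 + fpt p t $ 2 * f p t $ 1
      - (ft p t $ 2 * fp p t $ 1 + fpt p t $ 1 * f p t $ 2)" for p
  define B where "B p = fp p t $ 1 * ft p t $ 2 + fpt p t $ 2 * f p t $ 1
      - (fp p t $ 2 * ft p t $ 1 + fpt p t $ 1 * f p t $ 2)" for p
  have leibniz: "((\<lambda>t. integral {0..1} (\<lambda>p. f p t $ 1 * fp p t $ 2 - f p t $ 2 * fp p t $ 1))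
      has_real_derivative integral {0..1} G) (at t within {0..})"
    unfolding G_def
    by (intro leibniz_half_line t continuous_intros cont DERIV_diff DERIV_mult component_deriv_t)
  have "((\<lambda>p. f p t $ 1 * ft p t $ 2 - f p t $ 2 * ft p t $ 1)
      has_real_derivative B p) (at p within {0..1})" for p
    unfolding B_def
    by (intro DERIV_diff DERIV_mult component_deriv_p t)
  then have "(B has_integral (f 1 t $ 1 * ft 1 t $ 2 - f 1 t $ 2 * ft 1 t $ 1
      - (f 0 t $ 1 * ft 0 t $ 2 - f 0 t $ 2 * ft 0 t $ 1))) {0..1}"
    by (intro fundamental_theorem_of_calculus)
      (auto simp: has_real_derivative_iff_has_vector_derivative[symmetric])
  then have B: "(B has_integral 0) {0..1}"
    using periodic[OF t, of 0] ft_periodic[OF t, of 0] by simp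
  have eq: "G p - B p = - 2 * (V p t * v p t)" for p
  proof -
    have "G p - B p = 2 * (ft p t $ 1 * fp p t $ 2 - ft p t $ 2 * fp p t $ 1)"
      by (simp add: G_def B_def algebra_simps)
    also have "\<dots> = - 2 * (V p t / v p t) * ((fp p t $ 1)\<^sup>2 + (fp p t $ 2)\<^sup>2)"
      by (simp add: normal[OF t] power2_eq_square algebra_simps)
    also have "\<dots> = - 2 * (V p t * v p t)"
      unfolding v_sq[symmetric] using v_pos[OF t, of p] by (simp add: power2_eq_square)
    finally show ?thesis .
  qed
  have "continuous_on {0..1} G"
    unfolding G_def using t
    by (intro continuous_intros cont_slice t)
  then have "(G has_integral integral {0..1} G) {0..1}"
    by (intro integrable_integral integrable_continuous_interval)
  from has_integral_diff[OF this B, unfolded eq]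
  have "integral {0..1} G = integral {0..1} (\<lambda>p. - 2 * (V p t * v p t))"
    by (simp only: diff_0_right integral_unique)
  then have "integral {0..1} G = - 2 * integral {0..1} (\<lambda>p. V p t * v p t)"
    by (simp only: integral_mult_right)
  with DERIV_cdivide[OF leibniz, of 2]
  have "((\<lambda>t. integral {0..1} (\<lambda>p. f p t $ 1 * fp p t $ 2 - f p t $ 2 * fp p t $ 1) / 2)
      has_real_derivative - integral {0..1} (\<lambda>p. V p t * v p t)) (at t within {0..})"
    by simp
  then show ?thesis
    by (rule has_field_derivative_transform_within[OF _ zero_less_one])
      (use t in \<open>auto simp: C2_closed_curve.signed_area_eq[OF C2_closed_curve]\<close>)
qed

text \<open>
  The integrand is the parameter derivative \<open>\<theta>p\<close> of the tangent angle. The angle is only defined modulo \<open>2 * pi\<close>,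
  but its derivatives \<open>\<theta>p\<close> and \<open>\<theta>t\<close> are single-valued, and the form they define is closed. So the time
  derivative of \<open>\<theta>p\<close> is the parameter derivative of the periodic function \<open>\<theta>t\<close> and has integral zero.
\<close>

lemma total_curvature_const:
  assumes "t \<ge> 0"
  shows "integral {0..1} (\<lambda>p. k p t * v p t) = integral {0..1} (\<lambda>p. k p 0 * v p 0)"
proof -
  define \<theta>p where "\<theta>p p t = (fp p t $ 1 * fpp p t $ 2 - fp p t $ 2 * fpp p t $ 1)
      / ((fp p t $ 1)\<^sup>2 + (fp p t $ 2)\<^sup>2)" for p t
  define \<theta>t where "\<theta>t p t = (fp p t $ 1 * fpt p t $ 2 - fp p t $ 2 * fpt p t $ 1)
      / ((fp p t $ 1)\<^sup>2 + (fp p t $ 2)\<^sup>2)" for p t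
  define \<theta>pt where "\<theta>pt p t =
      ((fp p t $ 1 * fppt p t $ 2 - fp p t $ 2 * fppt p t $ 1) *
        ((fp p t $ 1)\<^sup>2 + (fp p t $ 2)\<^sup>2)
      + (fpt p t $ 1 * fpp p t $ 2 - fpt p t $ 2 * fpp p t $ 1) *
        ((fp p t $ 1)\<^sup>2 + (fp p t $ 2)\<^sup>2)
      - (fp p t $ 1 * fpp p t $ 2 - fp p t $ 2 * fpp p t $ 1) *
        (2 * fp p t $ 1 * fpt p t $ 1 + 2 * fp p t $ 2 * fpt p t $ 2))
      / (((fp p t $ 1)\<^sup>2 + (fp p t $ 2)\<^sup>2) * ((fp p t $ 1)\<^sup>2 + (fp p t $ 2)\<^sup>2))" for p t
  have nz: "(fp p t $ 1)\<^sup>2 + (fp p t $ 2)\<^sup>2 \<noteq> 0" if "t \<ge> 0" for p t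
    using v_pos[OF that, of p] by (simp flip: v_sq)
  have time: "((\<lambda>t. \<theta>p p t) has_real_derivative \<theta>pt p t) (at t within {0..})" if t: "t \<ge> 0" for p t
    unfolding \<theta>p_def \<theta>pt_def
    using nz[OF t, of p]
    by (auto intro!: derivative_eq_intros component_deriv_t t simp: algebra_simps)
  have space: "((\<lambda>p. \<theta>t p t) has_real_derivative \<theta>pt p t) (at p within {0..1})" if t: "t \<ge> 0" for p t
  proof -
    have "((\<lambda>p. \<theta>t p t) has_real_derivative
      ((fp p t $ 1 * fppt p t $ 2 - fp p t $ 2 * fppt p t $ 1) *
        ((fp p t $ 1)\<^sup>2 + (fp p t $ 2)\<^sup>2)
      + (fpp p t $ 1 * fpt p t $ 2 - fpp p t $ 2 * fpt p t $ 1) *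
        ((fp p t $ 1)\<^sup>2 + (fp p t $ 2)\<^sup>2)
      - (fp p t $ 1 * fpt p t $ 2 - fp p t $ 2 * fpt p t $ 1) *
        (2 * fp p t $ 1 * fpp p t $ 1 + 2 * fp p t $ 2 * fpp p t $ 2))
      / (((fp p t $ 1)\<^sup>2 + (fp p t $ 2)\<^sup>2) * ((fp p t $ 1)\<^sup>2 + (fp p t $ 2)\<^sup>2)))
      (at p within {0..1})"
      unfolding \<theta>t_def
      using nz[OF t, of p]
      by (auto intro!: derivative_eq_intros component_deriv_p t simp: algebra_simps)
    then show ?thesis
      unfolding \<theta>pt_def
      by (rule DERIV_cong) (rule arg_cong2[where f = divide], simp_all add: power2_eq_square algebra_simps)
  qed
  have "((\<lambda>p. \<theta>pt p t) has_integral (\<theta>t 1 t - \<theta>t 0 t)) {0..1}" if "t \<ge> 0" for t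
    using space[OF that]
    by (intro fundamental_theorem_of_calculus)
      (auto simp: has_real_derivative_iff_has_vector_derivative[symmetric])
  moreover have "\<theta>t 1 t = \<theta>t 0 t" if "t \<ge> 0" for t
    using fp_periodic[OF that, of 0] fpt_periodic[OF that, of 0] by (simp add: \<theta>t_def)
  ultimately have zero: "integral {0..1} (\<lambda>p. \<theta>pt p t) = 0" if "t \<ge> 0" for t
    using that by (simp add: integral_unique)
  have "((\<lambda>t. integral {0..1} (\<lambda>p. \<theta>p p t)) has_real_derivative 0) (at t within {0..})"
    if "t \<ge> 0" for t
  proof -
    have "continuous_on (UNIV \<times> {0..}) (\<lambda>z. \<theta>p (fst z) (snd z))"
      unfolding \<theta>p_def by (intro continuous_intros cont) (use nz in auto)
    moreover have "continuous_on (UNIV \<times> {0..}) (\<lambda>z. \<theta>pt (fst z) (snd z))"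
      unfolding \<theta>pt_def by (intro continuous_intros cont) (use nz in auto)
    ultimately show ?thesis using leibniz_half_line[of \<theta>p \<theta>pt t, OF time _ _ that] zero[OF that] by simp
  qed
  then obtain C where "\<And>t. t \<in> {0..} \<Longrightarrow> integral {0..1} (\<lambda>p. \<theta>p p t) = C"
    using has_field_derivative_zero_constant[of "{0..}" "\<lambda>t. integral {0..1} (\<lambda>p. \<theta>p p t)"]
    by auto
  moreover have "k p t * v p t = \<theta>p p t" if "t \<ge> 0" for p t
    using v_pos[OF that, of p]
    unfolding k_def \<theta>p_def v_sq[symmetric] by (simp add: power2_eq_square power3_eq_cube)
  ultimately show ?thesis using assms by simp
qed

end

section \<open>Convergence of the flow\<close>

lemma global_solution_smooth_family:
  assumes "global_solution F"
  obtains fp fpp ft fpt fppt where "smooth_curve_family F fp fpp ft fpt fppt"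
proof -
  obtain D :: "nat \<Rightarrow> nat \<Rightarrow> real \<Rightarrow> real \<Rightarrow> real ^ 2" where
    D00: "\<And>p t. t \<ge> 0 \<Longrightarrow> D 0 0 p t = F p t"
    and D_cont: "\<And>i j. continuous_on (UNIV \<times> {0..}) (\<lambda>(p, t). D i j p t)"
    and Dp: "\<And>i j p t. t \<ge> 0 \<Longrightarrow> ((\<lambda>q. D i j q t) has_vector_derivative D (Suc i) j p t) (at p)"
    and Dt: "\<And>i j p t. t \<ge> 0 \<Longrightarrow>
      ((\<lambda>\<tau>. D i j p \<tau>) has_vector_derivative D i (Suc j) p t) (at t within {0..})"
    using assms unfolding global_solution_def smooth_family_def by metis
  have curve_eq: "(\<lambda>p. F p t) = (\<lambda>p. D 0 0 p t)" if "t \<ge> 0" for t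
    using D00 that by auto
  have closed: "closed_immersed_curve (\<lambda>p. F p t)" if "t \<ge> 0" for t
    using assms that unfolding global_solution_def by simp
  have Fp: "((\<lambda>q. F q t) has_vector_derivative D (Suc 0) 0 p t) (at p)" if "t \<ge> 0" for p t
    unfolding curve_eq[OF that] by (rule Dp[OF that])
  have Ft: "((\<lambda>\<tau>. F p \<tau>) has_vector_derivative D 0 (Suc 0) p t) (at t within {0..})"
    if "t \<ge> 0" for p t
    by (rule has_vector_derivative_transform[OF _ _ Dt[OF that]]) (use that D00 in auto)
  have nz: "D (Suc 0) 0 p t \<noteq> 0" if "t \<ge> 0" for p t
    using closed[OF that] vector_derivative_at[OF Fp[OF that]]
    by (auto simp: closed_immersed_curve_def)
  have F_cont: "continuous_on (UNIV \<times> {0..}) (\<lambda>z. F (fst z) (snd z))"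
    using D_cont[of 0 0] by (rule continuous_on_eq) (use D00 in auto)
  have "smooth_curve_family F (D (Suc 0) 0) (D (Suc (Suc 0)) 0)
      (D 0 (Suc 0)) (D (Suc 0) (Suc 0)) (D (Suc (Suc 0)) (Suc 0))"
    by unfold_locales
      (use closed Dp Dt Fp Ft nz F_cont D_cont in \<open>auto simp: closed_immersed_curve_def split_beta\<close>)
  then show thesis by (rule that)
qed

theorem theorem4p1:
  fixes F :: "real \<Rightarrow> real \<Rightarrow> real ^ 2"
    and A L I :: "real \<Rightarrow> real"
  defines "A \<equiv> \<lambda>t. signed_area (\<lambda>p. F p t)"
    and "L \<equiv> \<lambda>t. curve_length (\<lambda>p. F p t)"
    and "I \<equiv> \<lambda>t. isoperimetric_deficit (\<lambda>p. F p t)"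
  assumes "global_solution F"
    and "rotation_number (\<lambda>p. F p 0) = 1"
    and "A 0 > 0"
  shows "(\<exists>C>0. \<exists>r>0. \<forall>t\<ge>0. 0 \<le> I t \<and> I t \<le> C * exp (- r * t)) \<and>
    (\<exists>A_inf>0. \<exists>L_inf>0.
       (A \<longlongrightarrow> A_inf) at_top \<and> (L \<longlongrightarrow> L_inf) at_top \<and>
       4 * pi * A_inf = L_inf\<^sup>2 \<and>
       (\<exists>C>0. \<exists>r>0. \<forall>t\<ge>0.
          0 \<le> A_inf - A t \<and> A_inf - A t \<le> C * exp (- r * t) \<and>
          \<bar>L t - L_inf\<bar> \<le> C * exp (- r * t)))"
proof -
  obtain fp fpp ft fpt fppt where "smooth_curve_family F fp fpp ft fpt fppt"
    using global_solution_smooth_family[OF \<open>global_solution F\<close>] .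
  then interpret smooth_curve_family F fp fpp ft fpt fppt .
  have A_nz: "A t \<noteq> 0" if "t \<ge> 0" for t
    using \<open>global_solution F\<close> that unfolding global_solution_def A_def by simp
  define V where "V p t = k p t - L t / (2 * A t)" for p t
  have normal: "ft p t = (V p t / v p t) *\<^sub>R quarter_turn (fp p t)" if t: "t \<ge> 0" for p t
  proof -
    interpret C2_closed_curve "\<lambda>p. F p t" "\<lambda>p. fp p t" "\<lambda>p. fpp p t"
      by (rule C2_closed_curve[OF t])
    let ?s = "arclength (\<lambda>q. F q t) p"
    have "((\<lambda>\<tau>. F p \<tau>) has_vector_derivative
           curvature_vector (\<lambda>q. F q t) ?s
             - (L t / (2 * A t)) *\<^sub>R unit_normal (\<lambda>q. F q t) ?s) (at t within {0..})"
      using \<open>global_solution F\<close> t unfolding global_solution_def Let_def A_def L_def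
      by simp
    moreover have "((\<lambda>\<tau>. F p \<tau>) has_vector_derivative ft p t) (at t within {0..})"
      by (rule deriv_t(1)[OF t])
    ultimately have "ft p t = curvature_vector (\<lambda>q. F q t) ?s
             - (L t / (2 * A t)) *\<^sub>R unit_normal (\<lambda>q. F q t) ?s"
      using vector_derivative_unique_within[OF at_within_half_line_nontrivial[OF t]] by metis
    also have "\<dots> = V p t *\<^sub>R unit_normal (\<lambda>q. F q t) ?s"
      by (simp add: curvature_vector_eq param_curvature_eq[OF t] V_def scaleR_diff_left)
    also have "\<dots> = (V p t / v p t) *\<^sub>R quarter_turn (fp p t)"
      by (simp add: unit_normal_eq speed_eq[OF t])
    finally show ?thesis .
  qed
  define K where "K t = integral {0..1} (\<lambda>p. (k p t)\<^sup>2 * v p t)" for t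
  have rotation: "rotation_number (\<lambda>p. F p t) = integral {0..1} (\<lambda>p. k p t * v p t) / (2 * pi)"
    if "t \<ge> 0" for t
    using C2_closed_curve.rotation_number_eq[OF C2_closed_curve[OF that]]
    by (simp add: speed_eq param_curvature_eq that)
  have total: "integral {0..1} (\<lambda>p. k p t * v p t) = 2 * pi" if "t \<ge> 0" for t
    using total_curvature_const[OF that] rotation[of 0]
      \<open>rotation_number (\<lambda>p. F p 0) = 1\<close> by simp
  have cont: "continuous_on {0..1} (\<lambda>p. v p t)" "continuous_on {0..1} (\<lambda>p. k p t)" if "t \<ge> 0" for t
    using C2_closed_curve.cont_speed[OF C2_closed_curve[OF that]]
      C2_closed_curve.cont_param_curvature[OF C2_closed_curve[OF that]]
    by (simp_all add: speed_eq param_curvature_eq that)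
  note int = integrable_integral[OF integrable_continuous_interval]
  have L_int: "integral {0..1} (\<lambda>p. v p t) = L t" if "t \<ge> 0" for t
    using C2_closed_curve.curve_length_eq[OF C2_closed_curve[OF that]]
    by (simp add: speed_eq L_def that)
  have L_deriv: "(L has_real_derivative pi * L t / A t - K t) (at t within {0..})" if t: "t \<ge> 0" for t
  proof -
    have "((\<lambda>p. (k p t)\<^sup>2 * v p t - L t / (2 * A t) * (k p t * v p t)) has_integral
        (K t - L t / (2 * A t) * (2 * pi))) {0..1}"
      unfolding K_def total[OF t, symmetric]
      by (intro has_integral_diff has_integral_mult_right int continuous_intros cont t)
    then have "integral {0..1} (\<lambda>p. V p t * k p t * v p t) = K t - L t / (2 * A t) * (2 * pi)"
      by (intro integral_unique) (simp add: V_def power2_eq_square algebra_simps)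
    with length_deriv[OF normal t]
    have "((\<lambda>t. curve_length (\<lambda>p. F p t)) has_real_derivative pi * L t / A t - K t) (at t within {0..})"
      by (simp add: mult.commute)
    then show ?thesis
      by (rule has_field_derivative_transform_within[OF _ zero_less_one]) (use t in \<open>auto simp: L_def\<close>)
  qed
  have A_deriv: "(A has_real_derivative (L t)\<^sup>2 / (2 * A t) - 2 * pi) (at t within {0..})"
    if t: "t \<ge> 0" for t
  proof -
    have "((\<lambda>p. k p t * v p t - L t / (2 * A t) * v p t) has_integral
        (2 * pi - L t / (2 * A t) * L t)) {0..1}"
      unfolding total[OF t, symmetric] L_int[OF t, symmetric]
      by (intro has_integral_diff has_integral_mult_right int continuous_intros cont t)
    then have "integral {0..1} (\<lambda>p. V p t * v p t) = 2 * pi - L t / (2 * A t) * L t"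
      by (intro integral_unique) (simp add: V_def algebra_simps)
    with area_deriv[OF normal t]
    have "((\<lambda>t. signed_area (\<lambda>p. F p t)) has_real_derivative (L t)\<^sup>2 / (2 * A t) - 2 * pi)
        (at t within {0..})"
      by (simp add: power2_eq_square)
    then show ?thesis
      by (rule has_field_derivative_transform_within[OF _ zero_less_one]) (use t in \<open>auto simp: A_def\<close>)
  qed
  show ?thesis
  proof (rule deficit_ode_convergence[OF A_deriv L_deriv A_nz \<open>A 0 > 0\<close>])
    fix t :: real assume t: "t \<ge> 0"
    show "L t > 0"
      using C2_closed_curve.curve_length_pos[OF C2_closed_curve[OF t]] by (simp add: L_def t)
    show "0 \<le> I t"
      using C2_closed_curve.isoperimetric_deficit_nonneg[OF C2_closed_curve[OF t]]
      by (simp add: I_def t)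
    have "rotation_number (\<lambda>p. F p t) = 1" using rotation[OF t] total[OF t] by simp
    from C2_closed_curve.isoperimetric_deficit_le_curvature_energy[OF C2_closed_curve[OF t] this]
    show "2 * pi\<^sup>2 * I t \<le> L t * K t - 4 * pi\<^sup>2"
      by (simp add: I_def L_def K_def t speed_eq param_curvature_eq)
  qed (simp_all add: I_def A_def L_def isoperimetric_deficit_def)
qed

end
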